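(* Let $\sigma_1:(M_1^*,\alpha_1^* )\rightarrow (L_1,\alpha_1)$ and $\sigma_2:(M_2^*,\alpha_2^* )\rightarrow (L_2,\alpha_2)$ be relative central extensions of the pairs of Hom-Lie algebras $(M_1,L_1)$ and $(M_2,L_2)$ respectively, and let $\gamma:(L_1,\alpha_1)\rightarrow (L_2,\alpha_2)$ be an isomorphism of Hom-Lie algebras with $\gamma(M_1)=M_2$. Let $$\overline{M^*}=\{(m_1,m_2)\in M_1^*\times M_2^* \mid \gamma\sigma_1(\alpha_1^*(m_1))=\sigma_2(\alpha_2^*(m_2))\},$$ with the action of $L_1$ given by ${}^{l_1}(m_1,m_2)=({}^{l_1}m_1,{}^{l_2}m_2)$, where $\gamma\alpha_1(l_1)=\alpha_2(l_2)$, and let $A=\overline{M^*}/[\overline{M^*},L_1]$ (an abelian Hom-Lie algebra). Then $\gamma$ induces an isoclinism from $\sigma_1$ to $\sigma_2$ if and only if for some ideal $T$ of $M_1^*\times A$ with $T\subseteq \mathrm{Ker}(\sigma_1\pi_{M_1^*})$, there exist isoclinic monomorphisms from $\sigma_1$ and from $\sigma_2$ into the relative central extension $\overline{\sigma_1\pi_{M_1^*}}:(M_1^*\times A)/T\rightarrow L_1$ induced by $\sigma_1\pi_{M_1^*}$.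
   Context: All vector spaces are over a fixed field. A Hom-Lie algebra $(L,\alpha_L)$ is a vector space $L$ with a bilinear map $[\cdot,\cdot]:L\times L\to L$ and a linear map $\alpha_L:L\to L$ such that $[x,y]=-[y,x]$ and $[\alpha_L(x),[y,z]]+[\alpha_L(y),[z,x]]+[\alpha_L(z),[x,y]]=0$ for all $x,y,z\in L$. It is regular if $\alpha_L$ is bijective and $\alpha_L([x,y])=[\alpha_L(x),\alpha_L(y)]$ for all $x,y$. All given Hom-Lie algebras are assumed regular. A homomorphism of Hom-Lie algebras is a linear map preserving brackets and commuting with the maps $\alpha$. A Hom-Lie subalgebra is a subspace closed under the bracket and under $\alpha_L$; it is an ideal $H$ of $L$ if moreover $[x,y]\in H$ for all $x\in H$, $y\in L$. A Hom-Lie algebra is abelian if its bracket is zero. Products carry componentwise bracket and twisting map; quotients carry the induced ones. A pair of Hom-Lie algebras $(M,L)$ is a Hom-Lie algebra $(L,\alpha_L)$ with an ideal $M$ of $L$. A Hom-action of $(L,\alpha_L)$ on $(K,\alpha_K)$ is a linear map $L\otimes K\to K$, $x\otimes k\mapsto {}^xk$, such that for all $x,y\in L$, $k,k'\in K$: ${}^{[x,y]}\alpha_K(k)={}^{\alpha_L(x)}({}^yk)-{}^{\alpha_L(y)}({}^xk)$; ${}^{\alpha_L(x)}[k,k']=[{}^xk,\alpha_K(k')]+[\alpha_K(k),{}^xk']$; $\alpha_K({}^xk)={}^{\alpha_L(x)}\alpha_K(k)$. A relative central extension of a pair $(M,L)$ is a homomorphism of Hom-Lie algebras $\sigma:(M^*,\alpha_*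 )\to(L,\alpha_L)$ together with a Hom-action of $L$ on $M^*$ such that (1) $\sigma(M^* )=M$; (2) $\sigma({}^l\alpha_*(m))=[\alpha_L(l),\sigma(\alpha_*(m))]$ for all $l\in L$, $m\in M^*$; (3) ${}^{\sigma(m')}\alpha_*(m)=[m',m]$ for all $m,m'\in M^*$. The $L$-commutator subalgebra $[M^*,L]$ of $M^*$ is the span of the elements ${}^l\alpha_*(m)$, $l\in L$, $m\in M^*$; $[\overline{M^*},L_1]$ is defined in the same way from the action of $L_1$ on $\overline{M^*}$. Let $\sigma_i:(M_i^*,\alpha_i^* )\to(L_i,\alpha_i)$ be relative central extensions of $(M_i,L_i)$, $i=1,2$. A morphism $(\gamma,\beta):\sigma_1\to\sigma_2$ consists of Hom-Lie homomorphisms $\gamma:L_1\to L_2$ and $\beta:M_1^*\to M_2^*$ with $\gamma(M_1)=M_2$, $\beta([M_1^*,L_1])=[M_2^*,L_2]$ and $\gamma\sigma_1(m_1)=\sigma_2\beta(m_1)$ for all $m_1\in M_1^*$. An isoclinism from $\sigma_1$ to $\sigma_2$ is a pair $(\gamma,\beta')$ of Hom-Lie isomorphisms $\gamma:L_1\to L_2$ with $\gamma(M_1)=M_2$ and $\beta':[M_1^*,L_1]\to[M_2^*,L_2]$ such that for all $m_1\in M_1^*$, $l_1\in L_1$ we have $\beta'({}^{l_1}\alpha_1^*(m_1))={}^{l_2}\alpha_2^*(m_2)$ whenever $m_2\in M_2^*$, $l_2\in L_2$ satisfy $\gamma\sigma_1(\alpha_1^*(m_1))=\sigma_2(\alpha_2^*(m_2))$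 and $\gamma\alpha_1(l_1)=\alpha_2(l_2)$. An isomorphism $\gamma:L_1\to L_2$ with $\gamma(M_1)=M_2$ induces an isoclinism from $\sigma_1$ to $\sigma_2$ if there is $\beta'$ such that $(\gamma,\beta')$ is an isoclinism. A morphism $(\gamma,\beta):\sigma_1\to\sigma_2$ is isoclinic if $(\gamma,\beta|_{[M_1^*,L_1]})$ is an isoclinism from $\sigma_1$ to $\sigma_2$; an isoclinic monomorphism is an isoclinic morphism $(\gamma,\beta)$ with $\beta$ injective. For a relative central extension $\sigma:M^*\to L$ of $(M,L)$ and an abelian Hom-Lie algebra $A$, $\pi_{M^*}:M^*\times A\to M^*$ is the projection, and $\sigma\pi_{M^*}:M^*\times A\to L$ is taken as a relative central extension of $(M,L)$ with the action ${}^l(m,a)=({}^lm,0)$. For a relative central extension $\sigma:M^*\to L$ and an ideal $N$ of $M^*$ with $N\subseteq\mathrm{Ker}\,\sigma$, the induced map $\bar\sigma:M^*/N\to L$ is a relative central extension of $(M,L)$ with the action ${}^l(m+N)={}^lm+N$.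
   Formalization: The L-components γ₁, γ₂ of the two isoclinic monomorphisms must satisfy γ₁ = γ₂∘γ (with unrelated components "if" fails), and T must be such that the induced map on (M₁*×A)/T is a relative central extension (the action is undefined for T not stable under L₁). *)

theory Defs
  imports "HOL-Algebra.Module" "HOL-Algebra.AbelCoset"
begin

(* The ring fields mult and one inherited from the module record play no role; see Module.module,
   which only constrains the additive group and the scalar multiplication. *)
record ('k, 'a) hom_lie = "('k, 'a) module" +
  bracket :: "'a \<Rightarrow> 'a \<Rightarrow> 'a"
  twist :: "'a \<Rightarrow> 'a"

definition linear_map ::
  "('k, 'r) ring_scheme \<Rightarrow> ('k, 'a, 's) module_scheme \<Rightarrow> ('k, 'b, 't) module_scheme \<Rightarrow> ('a \<Rightarrow> 'b) \<Rightarrow> bool"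
  where "linear_map K V W f \<longleftrightarrow>
    f \<in> carrier V \<rightarrow> carrier W \<and>
    (\<forall>x\<in>carrier V. \<forall>y\<in>carrier V. f (x \<oplus>\<^bsub>V\<^esub> y) = f x \<oplus>\<^bsub>W\<^esub> f y) \<and>
    (\<forall>a\<in>carrier K. \<forall>x\<in>carrier V. f (a \<odot>\<^bsub>V\<^esub> x) = a \<odot>\<^bsub>W\<^esub> f x)"

definition bilinear_map ::
  "('k, 'r) ring_scheme \<Rightarrow> ('k, 'a, 's) module_scheme \<Rightarrow> ('k, 'b, 't) module_scheme \<Rightarrow>
   ('k, 'c, 'u) module_scheme \<Rightarrow> ('a \<Rightarrow> 'b \<Rightarrow> 'c) \<Rightarrow> bool"
  where "bilinear_map K U V W f \<longleftrightarrow>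
    (\<forall>u\<in>carrier U. linear_map K V W (f u)) \<and>
    (\<forall>v\<in>carrier V. linear_map K U W (\<lambda>u. f u v))"

definition lin_span ::
  "('k, 'r) ring_scheme \<Rightarrow> ('k, 'a, 's) module_scheme \<Rightarrow> 'a set \<Rightarrow> 'a set"
  where "lin_span K V S = \<Inter>{W. submodule W K V \<and> S \<subseteq> W}"


section \<open>Hom-Lie algebras\<close>

locale hom_lie_algebra = R?: field K + module K L
  for K :: "('k, 'r) ring_scheme" (structure) and L :: "('k, 'a) hom_lie" (structure) +
  assumes bracket_bilinear: "bilinear_map K L L L (bracket L)"
    and twist_linear: "linear_map K L L (twist L)"
    and skew: "\<lbrakk>x \<in> carrier L; y \<in> carrier L\<rbrakk> \<Longrightarrow> bracket L x y = \<ominus>\<^bsub>L\<^esub> bracket L y x"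
    and hom_jacobi: "\<lbrakk>x \<in> carrier L; y \<in> carrier L; z \<in> carrier L\<rbrakk> \<Longrightarrow>
      bracket L (twist L x) (bracket L y z) \<oplus>\<^bsub>L\<^esub> bracket L (twist L y) (bracket L z x)
        \<oplus>\<^bsub>L\<^esub> bracket L (twist L z) (bracket L x y) = \<zero>\<^bsub>L\<^esub>"

definition regular :: "('k, 'a) hom_lie \<Rightarrow> bool"
  where "regular L \<longleftrightarrow>
    bij_betw (twist L) (carrier L) (carrier L) \<and>
    (\<forall>x\<in>carrier L. \<forall>y\<in>carrier L. twist L (bracket L x y) = bracket L (twist L x) (twist L y))"

definition hom_lie_hom ::
  "('k, 'r) ring_scheme \<Rightarrow> ('k, 'a) hom_lie \<Rightarrow> ('k, 'b) hom_lie \<Rightarrow> ('a \<Rightarrow> 'b) \<Rightarrow> bool"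
  where "hom_lie_hom K L L' f \<longleftrightarrow>
    linear_map K L L' f \<and>
    (\<forall>x\<in>carrier L. \<forall>y\<in>carrier L. f (bracket L x y) = bracket L' (f x) (f y)) \<and>
    (\<forall>x\<in>carrier L. f (twist L x) = twist L' (f x))"

definition hom_lie_iso ::
  "('k, 'r) ring_scheme \<Rightarrow> ('k, 'a) hom_lie \<Rightarrow> ('k, 'b) hom_lie \<Rightarrow> ('a \<Rightarrow> 'b) \<Rightarrow> bool"
  where "hom_lie_iso K L L' f \<longleftrightarrow> hom_lie_hom K L L' f \<and> bij_betw f (carrier L) (carrier L')"

definition hom_lie_subalgebra ::
  "('k, 'r) ring_scheme \<Rightarrow> 'a set \<Rightarrow> ('k, 'a) hom_lie \<Rightarrow> bool"
  where "hom_lie_subalgebra K H L \<longleftrightarrow>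
    submodule H K L \<and>
    (\<forall>x\<in>H. \<forall>y\<in>H. bracket L x y \<in> H) \<and>
    (\<forall>x\<in>H. twist L x \<in> H)"

definition hom_lie_ideal ::
  "('k, 'r) ring_scheme \<Rightarrow> 'a set \<Rightarrow> ('k, 'a) hom_lie \<Rightarrow> bool"
  where "hom_lie_ideal K H L \<longleftrightarrow>
    hom_lie_subalgebra K H L \<and> (\<forall>x\<in>H. \<forall>y\<in>carrier L. bracket L x y \<in> H)"

definition hom_lie_prod :: "('k, 'a) hom_lie \<Rightarrow> ('k, 'b) hom_lie \<Rightarrow> ('k, 'a \<times> 'b) hom_lie"
  where "hom_lie_prod L L' =
    \<lparr>carrier = carrier L \<times> carrier L', mult = undefined, one = undefined,
     zero = (\<zero>\<^bsub>L\<^esub>, \<zero>\<^bsub>L'\<^esub>),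
     add = (\<lambda>x y. (fst x \<oplus>\<^bsub>L\<^esub> fst y, snd x \<oplus>\<^bsub>L'\<^esub> snd y)),
     smult = (\<lambda>a x. (a \<odot>\<^bsub>L\<^esub> fst x, a \<odot>\<^bsub>L'\<^esub> snd x)),
     bracket = (\<lambda>x y. (bracket L (fst x) (fst y), bracket L' (snd x) (snd y))),
     twist = (\<lambda>x. (twist L (fst x), twist L' (snd x)))\<rparr>"

(* As for rcoset_mult in QuotRing, an operation on cosets is the union of the cosets
   of the results on all representatives. *)
definition hom_lie_quot :: "('k, 'a) hom_lie \<Rightarrow> 'a set \<Rightarrow> ('k, 'a set) hom_lie"
  where "hom_lie_quot L N =
    \<lparr>carrier = a_rcosets\<^bsub>L\<^esub> N, mult = undefined, one = undefined,
     zero = N,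
     add = set_add L,
     smult = (\<lambda>a X. \<Union>x\<in>X. N +>\<^bsub>L\<^esub> (a \<odot>\<^bsub>L\<^esub> x)),
     bracket = (\<lambda>X Y. \<Union>x\<in>X. \<Union>y\<in>Y. N +>\<^bsub>L\<^esub> bracket L x y),
     twist = (\<lambda>X. \<Union>x\<in>X. N +>\<^bsub>L\<^esub> twist L x)\<rparr>"

definition hom_action ::
  "('k, 'r) ring_scheme \<Rightarrow> ('k, 'l) hom_lie \<Rightarrow> ('k, 'm) hom_lie \<Rightarrow> ('l \<Rightarrow> 'm \<Rightarrow> 'm) \<Rightarrow> bool"
  where "hom_action K L M act \<longleftrightarrow>
    bilinear_map K L M M act \<and>
    (\<forall>x\<in>carrier L. \<forall>y\<in>carrier L. \<forall>k\<in>carrier M.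
      act (bracket L x y) (twist M k) =
        act (twist L x) (act y k) \<ominus>\<^bsub>M\<^esub> act (twist L y) (act x k)) \<and>
    (\<forall>x\<in>carrier L. \<forall>k\<in>carrier M. \<forall>k'\<in>carrier M.
      act (twist L x) (bracket M k k') =
        bracket M (act x k) (twist M k') \<oplus>\<^bsub>M\<^esub> bracket M (twist M k) (act x k')) \<and>
    (\<forall>x\<in>carrier L. \<forall>k\<in>carrier M. twist M (act x k) = act (twist L x) (twist M k))"

(* [M*, L] for an action of L on M* *)
definition commutator ::
  "('k, 'r) ring_scheme \<Rightarrow> ('k, 'm) hom_lie \<Rightarrow> ('k, 'l) hom_lie \<Rightarrow> ('l \<Rightarrow> 'm \<Rightarrow> 'm) \<Rightarrow> 'm set"
  where "commutator K M L act =
    lin_span K M {act l (twist M m) | l m. l \<in> carrier L \<and> m \<in> carrier M}"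


section \<open>Relative central extensions\<close>

(* The data of sigma : M* -> L over the pair (M, L): base is L, base_ideal is M, cover is M*,
   proj is sigma. *)
record ('k, 'l, 'm) rel_ext =
  base :: "('k, 'l) hom_lie"
  base_ideal :: "'l set"
  cover :: "('k, 'm) hom_lie"
  proj :: "'m \<Rightarrow> 'l"
  act :: "'l \<Rightarrow> 'm \<Rightarrow> 'm"

locale relative_central_extension =
  fixes K :: "('k, 'r) ring_scheme" and E :: "('k, 'l, 'm) rel_ext"
  assumes base_hom_lie: "hom_lie_algebra K (base E)"
    and cover_hom_lie: "hom_lie_algebra K (cover E)"
    and ideal: "hom_lie_ideal K (base_ideal E) (base E)"
    and proj_hom: "hom_lie_hom K (cover E) (base E) (proj E)"
    and action: "hom_action K (base E) (cover E) (act E)"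
    and proj_image: "proj E ` carrier (cover E) = base_ideal E"
    and proj_act: "\<lbrakk>l \<in> carrier (base E); m \<in> carrier (cover E)\<rbrakk> \<Longrightarrow>
      proj E (act E l (twist (cover E) m)) =
        bracket (base E) (twist (base E) l) (proj E (twist (cover E) m))"
    and act_proj: "\<lbrakk>m \<in> carrier (cover E); m' \<in> carrier (cover E)\<rbrakk> \<Longrightarrow>
      act E (proj E m') (twist (cover E) m) = bracket (cover E) m' m"

abbreviation ext_commutator :: "('k, 'r) ring_scheme \<Rightarrow> ('k, 'l, 'm) rel_ext \<Rightarrow> 'm set"
  where "ext_commutator K E \<equiv> commutator K (cover E) (base E) (act E)"

(* Both ends being relative central extensions is part of the notion.  This matters for
   quot_ext below: the induced action is well defined only on quotients by L-stable ideals. *)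
definition ext_morphism ::
  "('k, 'r) ring_scheme \<Rightarrow> ('k, 'l1, 'm1) rel_ext \<Rightarrow> ('k, 'l2, 'm2) rel_ext \<Rightarrow>
   ('l1 \<Rightarrow> 'l2) \<Rightarrow> ('m1 \<Rightarrow> 'm2) \<Rightarrow> bool"
  where "ext_morphism K E1 E2 \<gamma> \<beta> \<longleftrightarrow>
    relative_central_extension K E1 \<and> relative_central_extension K E2 \<and>
    hom_lie_hom K (base E1) (base E2) \<gamma> \<and>
    hom_lie_hom K (cover E1) (cover E2) \<beta> \<and>
    \<gamma> ` base_ideal E1 = base_ideal E2 \<and>
    \<beta> ` ext_commutator K E1 = ext_commutator K E2 \<and>
    (\<forall>m\<in>carrier (cover E1). \<gamma> (proj E1 m) = proj E2 (\<beta> m))"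

(* Only the values of \<beta>' on [M1*, L1] matter. *)
definition isoclinism ::
  "('k, 'r) ring_scheme \<Rightarrow> ('k, 'l1, 'm1) rel_ext \<Rightarrow> ('k, 'l2, 'm2) rel_ext \<Rightarrow>
   ('l1 \<Rightarrow> 'l2) \<Rightarrow> ('m1 \<Rightarrow> 'm2) \<Rightarrow> bool"
  where "isoclinism K E1 E2 \<gamma> \<beta>' \<longleftrightarrow>
    hom_lie_iso K (base E1) (base E2) \<gamma> \<and>
    \<gamma> ` base_ideal E1 = base_ideal E2 \<and>
    hom_lie_iso K (cover E1\<lparr>carrier := ext_commutator K E1\<rparr>)
      (cover E2\<lparr>carrier := ext_commutator K E2\<rparr>) \<beta>' \<and>
    (\<forall>m1\<in>carrier (cover E1). \<forall>l1\<in>carrier (base E1).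
     \<forall>m2\<in>carrier (cover E2). \<forall>l2\<in>carrier (base E2).
      \<gamma> (proj E1 (twist (cover E1) m1)) = proj E2 (twist (cover E2) m2) \<longrightarrow>
      \<gamma> (twist (base E1) l1) = twist (base E2) l2 \<longrightarrow>
      \<beta>' (act E1 l1 (twist (cover E1) m1)) = act E2 l2 (twist (cover E2) m2))"

definition induces_isoclinism ::
  "('k, 'r) ring_scheme \<Rightarrow> ('k, 'l1, 'm1) rel_ext \<Rightarrow> ('k, 'l2, 'm2) rel_ext \<Rightarrow> ('l1 \<Rightarrow> 'l2) \<Rightarrow> bool"
  where "induces_isoclinism K E1 E2 \<gamma> \<longleftrightarrow> (\<exists>\<beta>'. isoclinism K E1 E2 \<gamma> \<beta>')"

(* \<gamma> belongs to the datum, so two isoclinic monomorphisms into the same extension say something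
   about a prescribed isomorphism of the bases only if their \<gamma>-components are compatible with it. *)
definition isoclinic_mono ::
  "('k, 'r) ring_scheme \<Rightarrow> ('k, 'l1, 'm1) rel_ext \<Rightarrow> ('k, 'l2, 'm2) rel_ext \<Rightarrow>
   ('l1 \<Rightarrow> 'l2) \<Rightarrow> ('m1 \<Rightarrow> 'm2) \<Rightarrow> bool"
  where "isoclinic_mono K E1 E2 \<gamma> \<beta> \<longleftrightarrow>
    ext_morphism K E1 E2 \<gamma> \<beta> \<and> isoclinism K E1 E2 \<gamma> \<beta> \<and> inj_on \<beta> (carrier (cover E1))"

(* sigma pi : M* x A -> L *)
definition prod_ext ::
  "('k, 'l, 'm) rel_ext \<Rightarrow> ('k, 'a) hom_lie \<Rightarrow> ('k, 'l, 'm \<times> 'a) rel_ext"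
  where "prod_ext E A =
    \<lparr>base = base E, base_ideal = base_ideal E,
     cover = hom_lie_prod (cover E) A,
     proj = (\<lambda>x. proj E (fst x)),
     act = (\<lambda>l x. (act E l (fst x), \<zero>\<^bsub>A\<^esub>))\<rparr>"

abbreviation ext_kernel :: "('k, 'l, 'm) rel_ext \<Rightarrow> 'm set"
  where "ext_kernel E \<equiv> a_kernel (cover E) (base E) (proj E)"

(* The extension induced on M*/N, meaningful for N contained in the kernel. *)
definition quot_ext :: "('k, 'l, 'm) rel_ext \<Rightarrow> 'm set \<Rightarrow> ('k, 'l, 'm set) rel_ext"
  where "quot_ext E N =
    \<lparr>base = base E, base_ideal = base_ideal E,
     cover = hom_lie_quot (cover E) N,
     proj = (\<lambda>X. the_elem (proj E ` X)),
     act = (\<lambda>l X. \<Union>x\<in>X. N +>\<^bsub>cover E\<^esub> act E l x)\<rparr>"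


section \<open>The fibre product and its abelian quotient\<close>

definition fibre_prod ::
  "('k, 'l1, 'm1) rel_ext \<Rightarrow> ('k, 'l2, 'm2) rel_ext \<Rightarrow> ('l1 \<Rightarrow> 'l2) \<Rightarrow> ('k, 'm1 \<times> 'm2) hom_lie"
  where "fibre_prod E1 E2 \<gamma> = (hom_lie_prod (cover E1) (cover E2))
    \<lparr>carrier := {(m1, m2). m1 \<in> carrier (cover E1) \<and> m2 \<in> carrier (cover E2) \<and>
       \<gamma> (proj E1 (twist (cover E1) m1)) = proj E2 (twist (cover E2) m2)}\<rparr>"

(* l2 is the unique element with \<gamma> (twist l1) = twist l2; the twist of base E2 is bijective
   in the regular case. *)
definition fibre_act ::
  "('k, 'l1, 'm1) rel_ext \<Rightarrow> ('k, 'l2, 'm2) rel_ext \<Rightarrow> ('l1 \<Rightarrow> 'l2) \<Rightarrow> 'l1 \<Rightarrow> 'm1 \<times> 'm2 \<Rightarrow> 'm1 \<times> 'm2"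
  where "fibre_act E1 E2 \<gamma> l1 x =
    (let l2 = (THE l2. l2 \<in> carrier (base E2) \<and> \<gamma> (twist (base E1) l1) = twist (base E2) l2)
     in (act E1 l1 (fst x), act E2 l2 (snd x)))"

definition fibre_quot ::
  "('k, 'r) ring_scheme \<Rightarrow> ('k, 'l1, 'm1) rel_ext \<Rightarrow> ('k, 'l2, 'm2) rel_ext \<Rightarrow> ('l1 \<Rightarrow> 'l2) \<Rightarrow>
   ('k, ('m1 \<times> 'm2) set) hom_lie"
  where "fibre_quot K E1 E2 \<gamma> = hom_lie_quot (fibre_prod E1 E2 \<gamma>)
    (commutator K (fibre_prod E1 E2 \<gamma>) (base E1) (fibre_act E1 E2 \<gamma>))"

end

theory Submission
  imports Defs
begin

text \<open>
  Regularity turns the fibre product into \<open>{(x, y) | \<gamma> (\<sigma>\<^sub>1 x) = \<sigma>\<^sub>2 y}\<close>, with \<open>l\<close> acting by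
  \<open>(l, \<gamma> l)\<close>.  Given an isoclinism \<open>(\<gamma>, \<beta>')\<close>, the commutator of the fibre product lies on the
  graph of \<open>\<beta>'\<close>, hence contains no \<open>(x, 0)\<close> or \<open>(0, y)\<close> apart from \<open>0\<close>.  Take \<open>T\<close> to be the
  set of all \<open>(x, [x, 0])\<close> with \<open>x \<in> Ker \<sigma>\<^sub>1\<close>, where
  \<open>[x, y]\<close> denotes the class of \<open>(x, y)\<close> in \<open>A\<close>.  Then \<open>x \<mapsto> (x, 0) + T\<close> and
  \<open>y \<mapsto> (x, [x, y]) + T\<close>, for any \<open>x\<close> with \<open>\<gamma> (\<sigma>\<^sub>1 x) = \<sigma>\<^sub>2 y\<close>, are isoclinic monomorphisms over
  the identity and over \<open>\<gamma>\<close> inverse.  Conversely, isoclinic monomorphisms \<open>\<beta>\<^sub>1\<close>, \<open>\<beta>\<^sub>2\<close> into a common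
  extension restrict to isomorphisms onto the same commutator, and \<open>\<beta>\<^sub>2\<close> inverse composed with
  \<open>\<beta>\<^sub>1\<close> is an isoclinism.
\<close>

section \<open>Linear maps and spans\<close>

lemma linear_mapD:
  assumes "linear_map K V W f"
  shows "x \<in> carrier V \<Longrightarrow> f x \<in> carrier W"
    and "\<lbrakk>x \<in> carrier V; y \<in> carrier V\<rbrakk> \<Longrightarrow> f (x \<oplus>\<^bsub>V\<^esub> y) = f x \<oplus>\<^bsub>W\<^esub> f y"
    and "\<lbrakk>a \<in> carrier K; x \<in> carrier V\<rbrakk> \<Longrightarrow> f (a \<odot>\<^bsub>V\<^esub> x) = a \<odot>\<^bsub>W\<^esub> f x"
  using assms by (auto simp: linear_map_def)

lemma linear_map_zero:
  assumes "module K V" "module K W" "linear_map K V W f"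
  shows "f \<zero>\<^bsub>V\<^esub> = \<zero>\<^bsub>W\<^esub>"
proof -
  interpret V: module K V by fact
  interpret W: module K W by fact
  have "f (\<zero>\<^bsub>K\<^esub> \<odot>\<^bsub>V\<^esub> \<zero>\<^bsub>V\<^esub>) = \<zero>\<^bsub>K\<^esub> \<odot>\<^bsub>W\<^esub> f \<zero>\<^bsub>V\<^esub>"
    by (rule linear_mapD(3)[OF assms(3)]) auto
  then show ?thesis using linear_mapD(1)[OF assms(3)] by simp
qed

lemma linear_map_minus:
  assumes "module K V" "module K W" "linear_map K V W f" "x \<in> carrier V"
  shows "f (\<ominus>\<^bsub>V\<^esub> x) = \<ominus>\<^bsub>W\<^esub> f x"
proof -
  interpret V: module K V by fact
  interpret W: module K W by fact
  have "f (\<ominus>\<^bsub>V\<^esub> x) \<oplus>\<^bsub>W\<^esub> f x = \<zero>\<^bsub>W\<^esub>"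
    using linear_mapD(2)[OF assms(3), of "\<ominus>\<^bsub>V\<^esub> x" x] assms(4) linear_map_zero[OF assms(1-3)]
    by (simp add: V.l_neg)
  then show ?thesis
    using linear_mapD(1)[OF assms(3)] assms(4) by (simp add: W.minus_equality)
qed

lemma linear_map_diff:
  assumes "module K V" "module K W" "linear_map K V W f" "x \<in> carrier V" "y \<in> carrier V"
  shows "f (x \<ominus>\<^bsub>V\<^esub> y) = f x \<ominus>\<^bsub>W\<^esub> f y"
proof -
  interpret V: module K V by fact
  show ?thesis
    using assms by (simp add: a_minus_def linear_mapD(2)[OF assms(3)] linear_map_minus)
qed

lemma linear_map_inj_on:
  assumes "module K V" "module K W" "linear_map K V W f"
    and "\<And>x. \<lbrakk>x \<in> carrier V; f x = \<zero>\<^bsub>W\<^esub>\<rbrakk> \<Longrightarrow> x = \<zero>\<^bsub>V\<^esub>"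
  shows "inj_on f (carrier V)"
proof (rule inj_onI)
  interpret V: module K V by fact
  interpret W: module K W by fact
  fix x y assume xy: "x \<in> carrier V" "y \<in> carrier V" "f x = f y"
  then have "f (x \<ominus>\<^bsub>V\<^esub> y) = \<zero>\<^bsub>W\<^esub>"
    using linear_mapD(1)[OF assms(3) xy(2)] linear_map_diff[OF assms(1-3) xy(1,2)]
    by (simp add: a_minus_def W.r_neg)
  moreover have "x = x \<ominus>\<^bsub>V\<^esub> y \<oplus>\<^bsub>V\<^esub> y"
    using xy by (simp add: a_minus_def V.a_assoc V.l_neg)
  ultimately show "x = y" using assms(4)[of "x \<ominus>\<^bsub>V\<^esub> y"] xy by simp
qed

section \<open>Submodules, preimages, images and spans\<close>

lemma submoduleD:
  assumes "submodule H K V"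
  shows "x \<in> H \<Longrightarrow> x \<in> carrier V" "\<zero>\<^bsub>V\<^esub> \<in> H"
    "\<lbrakk>x \<in> H; y \<in> H\<rbrakk> \<Longrightarrow> x \<oplus>\<^bsub>V\<^esub> y \<in> H"
    "x \<in> H \<Longrightarrow> \<ominus>\<^bsub>V\<^esub> x \<in> H"
    "\<lbrakk>a \<in> carrier K; x \<in> H\<rbrakk> \<Longrightarrow> a \<odot>\<^bsub>V\<^esub> x \<in> H"
proof -
  interpret submodule H K V by fact
  show "x \<in> H \<Longrightarrow> x \<in> carrier V" "\<zero>\<^bsub>V\<^esub> \<in> H"
    "\<lbrakk>x \<in> H; y \<in> H\<rbrakk> \<Longrightarrow> x \<oplus>\<^bsub>V\<^esub> y \<in> H"
    "\<lbrakk>a \<in> carrier K; x \<in> H\<rbrakk> \<Longrightarrow> a \<odot>\<^bsub>V\<^esub> x \<in> H"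
    using subset one_closed m_closed by auto
  show "x \<in> H \<Longrightarrow> \<ominus>\<^bsub>V\<^esub> x \<in> H"
    using m_inv_closed by (auto simp: a_inv_def)
qed

text \<open>Closure under negation comes for free, since the negative of a vector is its multiple by
  the negative of the unit scalar.\<close>

lemma submoduleI_smult:
  assumes "module K V" "H \<subseteq> carrier V" "\<zero>\<^bsub>V\<^esub> \<in> H"
    "\<And>x y. \<lbrakk>x \<in> H; y \<in> H\<rbrakk> \<Longrightarrow> x \<oplus>\<^bsub>V\<^esub> y \<in> H"
    "\<And>a x. \<lbrakk>a \<in> carrier K; x \<in> H\<rbrakk> \<Longrightarrow> a \<odot>\<^bsub>V\<^esub> x \<in> H"
  shows "submodule H K V"
proof -
  interpret V: module K V by fact
  have "\<ominus>\<^bsub>V\<^esub> x \<in> H" if "x \<in> H" for x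
    using assms(5)[of "\<ominus>\<^bsub>K\<^esub> \<one>\<^bsub>K\<^esub>" x] that assms(2) by (auto simp: V.smult_l_minus)
  then show ?thesis
    using assms by (intro V.submoduleI) auto
qed

lemma submodule_vimage:
  assumes "module K V" "module K W" "linear_map K V W f" "submodule H K W"
  shows "submodule {x \<in> carrier V. f x \<in> H} K V"
proof -
  interpret V: module K V by fact
  show ?thesis
    using submoduleD[OF assms(4)] linear_mapD[OF assms(3)] linear_map_zero[OF assms(1-3)]
    by (intro submoduleI_smult assms(1)) auto
qed

lemma submodule_image:
  assumes "module K V" "module K W" "linear_map K V W f" "submodule H K V"
  shows "submodule (f ` H) K W"
proof -
  have "f x \<oplus>\<^bsub>W\<^esub> f y \<in> f ` H" if "x \<in> H" "y \<in> H" for x y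
    using that submoduleD[OF assms(4)] linear_mapD(2)[OF assms(3), of x y] by (metis imageI)
  moreover have "a \<odot>\<^bsub>W\<^esub> f x \<in> f ` H" if "a \<in> carrier K" "x \<in> H" for a x
    using that submoduleD[OF assms(4)] linear_mapD(3)[OF assms(3), of a x] by (metis imageI)
  moreover have "\<zero>\<^bsub>W\<^esub> \<in> f ` H"
    using submoduleD(2)[OF assms(4)] linear_map_zero[OF assms(1-3)] by (metis imageI)
  ultimately show ?thesis
    using submoduleD[OF assms(4)] linear_mapD[OF assms(3)]
    by (intro submoduleI_smult assms(2)) auto
qed

lemma lin_span_subset:
  assumes "submodule W K V" "S \<subseteq> W"
  shows "lin_span K V S \<subseteq> W"
  using assms by (auto simp: lin_span_def)

lemma subset_lin_span: "S \<subseteq> lin_span K V S"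
  by (auto simp: lin_span_def)

lemma submodule_carrier:
  assumes "module K V"
  shows "submodule (carrier V) K V"
proof -
  interpret V: module K V by fact
  show ?thesis by (intro submoduleI_smult assms) auto
qed

lemma submodule_lin_span:
  assumes "module K V" "S \<subseteq> carrier V"
  shows "submodule (lin_span K V S) K V"
  using lin_span_subset[OF submodule_carrier[OF assms(1)] assms(2)] assms(1)
  by (intro submoduleI_smult) (auto simp: lin_span_def dest: submoduleD)

text \<open>Both inclusions are minimality of a span: preimages and images of submodules under a
  linear map are submodules again.\<close>

lemma lin_span_image:
  assumes "module K V" "module K W" "linear_map K V W f" "S \<subseteq> carrier V"
  shows "f ` lin_span K V S = lin_span K W (f ` S)"
proof
  have fS: "f ` S \<subseteq> carrier W"
    using assms(4) linear_mapD(1)[OF assms(3)] by auto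
  have "lin_span K V S \<subseteq> {x \<in> carrier V. f x \<in> lin_span K W (f ` S)}"
    using assms(4) subset_lin_span[of "f ` S" K W]
    by (intro lin_span_subset submodule_vimage[OF assms(1-3)] submodule_lin_span assms(2) fS) auto
  then show "f ` lin_span K V S \<subseteq> lin_span K W (f ` S)" by auto
  show "lin_span K W (f ` S) \<subseteq> f ` lin_span K V S"
    by (intro lin_span_subset submodule_image[OF assms(1-3)] submodule_lin_span assms(1,4)
        image_mono subset_lin_span)
qed

section \<open>Constructions of hom-Lie algebras\<close>

context hom_lie_algebra
begin

lemma is_module: "module K L" ..

lemma
  shows bracket_linear_right: "x \<in> carrier L \<Longrightarrow> linear_map K L L (bracket L x)"
    and bracket_linear_left: "y \<in> carrier L \<Longrightarrow> linear_map K L L (\<lambda>x. bracket L x y)"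
  using bracket_bilinear by (auto simp: bilinear_map_def)

lemmas twist_simps [simp] = linear_mapD[OF twist_linear]
lemmas bracket_simps [simp] = linear_mapD[OF bracket_linear_right]
  linear_mapD(2,3)[OF bracket_linear_left]

lemmas twist_zero [simp] = linear_map_zero[OF is_module is_module twist_linear]
lemmas bracket_zero [simp] = linear_map_zero[OF is_module is_module bracket_linear_right]
  linear_map_zero[OF is_module is_module bracket_linear_left]

end

section \<open>Passing the axioms to images, subalgebras, products and quotients\<close>

lemma hom_lie_homD:
  assumes "hom_lie_hom K V W f"
  shows "linear_map K V W f"
    and "x \<in> carrier V \<Longrightarrow> f x \<in> carrier W"
    and "\<lbrakk>x \<in> carrier V; y \<in> carrier V\<rbrakk> \<Longrightarrow> f (x \<oplus>\<^bsub>V\<^esub> y) = f x \<oplus>\<^bsub>W\<^esub> f y"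
    and "\<lbrakk>a \<in> carrier K; x \<in> carrier V\<rbrakk> \<Longrightarrow> f (a \<odot>\<^bsub>V\<^esub> x) = a \<odot>\<^bsub>W\<^esub> f x"
    and "\<lbrakk>x \<in> carrier V; y \<in> carrier V\<rbrakk> \<Longrightarrow> f (bracket V x y) = bracket W (f x) (f y)"
    and "x \<in> carrier V \<Longrightarrow> f (twist V x) = twist W (f x)"
  using assms by (auto simp: hom_lie_hom_def linear_map_def)

text \<open>The module axioms are equations and existence statements, so they descend along a
  surjection that respects the operations. As \<open>W\<close> is not yet known to be a group,
  preservation of zero cannot be derived from linearity and is assumed.\<close>

lemma module_image:
  assumes "module K V" and f: "linear_map K V W f"
    and onto: "f ` carrier V = carrier W" and zero: "f \<zero>\<^bsub>V\<^esub> = \<zero>\<^bsub>W\<^esub>"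
  shows "module K W"
proof -
  interpret V: module K V by fact
  note f = linear_mapD[OF f]
  have ex: "\<exists>x\<in>carrier V. u = f x" if "u \<in> carrier W" for u
    using that onto by auto
  have grp: "abelian_group W"
  proof (rule abelian_groupI)
    show "\<zero>\<^bsub>W\<^esub> \<in> carrier W" using zero f(1)[OF V.zero_closed] by simp
    show "u \<oplus>\<^bsub>W\<^esub> v \<in> carrier W" if "u \<in> carrier W" "v \<in> carrier W" for u v
      using ex[OF that(1)] ex[OF that(2)] by (metis f(1,2) V.a_closed)
    show "u \<oplus>\<^bsub>W\<^esub> v \<oplus>\<^bsub>W\<^esub> w = u \<oplus>\<^bsub>W\<^esub> (v \<oplus>\<^bsub>W\<^esub> w)"
      if "u \<in> carrier W" "v \<in> carrier W" "w \<in> carrier W" for u v w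
      using ex[OF that(1)] ex[OF that(2)] ex[OF that(3)]
      by (elim bexE) (simp flip: f(2) add: V.a_assoc)
    show "u \<oplus>\<^bsub>W\<^esub> v = v \<oplus>\<^bsub>W\<^esub> u" if "u \<in> carrier W" "v \<in> carrier W" for u v
      using ex[OF that(1)] ex[OF that(2)] by (elim bexE) (simp flip: f(2) add: V.a_comm)
    show "\<zero>\<^bsub>W\<^esub> \<oplus>\<^bsub>W\<^esub> u = u" if "u \<in> carrier W" for u
      using ex[OF that] by (elim bexE) (simp flip: f(2) zero)
    show "\<exists>v\<in>carrier W. v \<oplus>\<^bsub>W\<^esub> u = \<zero>\<^bsub>W\<^esub>" if u: "u \<in> carrier W" for u
    proof -
      obtain x where x: "x \<in> carrier V" "u = f x" using ex[OF u] by auto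
      show ?thesis
        by (rule bexI[of _ "f (\<ominus>\<^bsub>V\<^esub> x)"]) (use x f in \<open>simp_all flip: f(2) zero add: V.l_neg\<close>)
    qed
  qed
  show ?thesis
  proof (rule moduleI)
    show "a \<odot>\<^bsub>W\<^esub> u \<in> carrier W" if "a \<in> carrier K" "u \<in> carrier W" for a u
      using ex[OF that(2)] that(1) by (metis f(1,3) V.smult_closed)
    show "(a \<oplus>\<^bsub>K\<^esub> b) \<odot>\<^bsub>W\<^esub> u = a \<odot>\<^bsub>W\<^esub> u \<oplus>\<^bsub>W\<^esub> b \<odot>\<^bsub>W\<^esub> u"
      if "a \<in> carrier K" "b \<in> carrier K" "u \<in> carrier W" for a b u
      using ex[OF that(3)] that(1,2) by (elim bexE) (simp flip: f(2,3) add: V.smult_l_distr)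
    show "a \<odot>\<^bsub>W\<^esub> (u \<oplus>\<^bsub>W\<^esub> v) = a \<odot>\<^bsub>W\<^esub> u \<oplus>\<^bsub>W\<^esub> a \<odot>\<^bsub>W\<^esub> v"
      if "a \<in> carrier K" "u \<in> carrier W" "v \<in> carrier W" for a u v
      using ex[OF that(2)] ex[OF that(3)] that(1)
      by (elim bexE) (simp flip: f(2,3) add: V.smult_r_distr)
    show "(a \<otimes>\<^bsub>K\<^esub> b) \<odot>\<^bsub>W\<^esub> u = a \<odot>\<^bsub>W\<^esub> (b \<odot>\<^bsub>W\<^esub> u)"
      if "a \<in> carrier K" "b \<in> carrier K" "u \<in> carrier W" for a b u
      using ex[OF that(3)] that(1,2) by (elim bexE) (simp flip: f(3) add: V.smult_assoc1)
    show "\<one>\<^bsub>K\<^esub> \<odot>\<^bsub>W\<^esub> u = u" if "u \<in> carrier W" for u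
      using ex[OF that] by (elim bexE) (simp flip: f(3))
  qed (use grp V.is_cring in auto)
qed

text \<open>Skew symmetry and the Hom-Jacobi identity are equations, so they too descend along a
  surjection. Applied to the coset map, this gives the axioms of a quotient without calculating with
  cosets.\<close>

lemma hom_lie_algebra_image:
  assumes "hom_lie_algebra K V" and hom: "hom_lie_hom K V W f"
    and onto: "f ` carrier V = carrier W" and zero: "f \<zero>\<^bsub>V\<^esub> = \<zero>\<^bsub>W\<^esub>"
  shows "hom_lie_algebra K W"
proof -
  interpret V: hom_lie_algebra K V by fact
  note f = hom_lie_homD[OF hom]
  interpret W: module K W
    by (rule module_image[OF V.is_module f(1) onto zero])
  have ex: "\<exists>x\<in>carrier V. u = f x" if "u \<in> carrier W" for u
    using that onto by auto
  note minus = linear_map_minus[OF V.is_module W.module_axioms f(1)]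
  show ?thesis
  proof
    show "linear_map K W W (twist W)"
      unfolding linear_map_def onto[symmetric] Pi_iff ball_simps
      by (simp flip: f(3,4,6))
    show "bilinear_map K W W W (bracket W)"
      unfolding bilinear_map_def linear_map_def onto[symmetric] Pi_iff ball_simps
      by (simp flip: f(3,4,5))
    show "bracket W u v = \<ominus>\<^bsub>W\<^esub> bracket W v u" if uv: "u \<in> carrier W" "v \<in> carrier W" for u v
    proof -
      obtain x y where "x \<in> carrier V" "u = f x" "y \<in> carrier V" "v = f y"
        using ex[OF uv(1)] ex[OF uv(2)] by blast
      then show ?thesis
        using V.skew[of x y] by (simp flip: f(5) minus)
    qed
    show "bracket W (twist W u) (bracket W v w) \<oplus>\<^bsub>W\<^esub> bracket W (twist W v) (bracket W w u)
        \<oplus>\<^bsub>W\<^esub> bracket W (twist W w) (bracket W u v) = \<zero>\<^bsub>W\<^esub>"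
      if uvw: "u \<in> carrier W" "v \<in> carrier W" "w \<in> carrier W" for u v w
    proof -
      obtain x y z where "x \<in> carrier V" "u = f x" "y \<in> carrier V" "v = f y"
        "z \<in> carrier V" "w = f z"
        using ex[OF uvw(1)] ex[OF uvw(2)] ex[OF uvw(3)] by blast
      then show ?thesis
        using V.hom_jacobi[of x y z] by (simp flip: f(3,5,6) zero)
    qed
  qed
qed

lemma hom_lie_algebra_subalgebra:
  assumes "hom_lie_algebra K V" "hom_lie_subalgebra K H V"
  shows "hom_lie_algebra K (V\<lparr>carrier := H\<rparr>)"
proof -
  interpret V: hom_lie_algebra K V by fact
  have sub: "submodule H K V" and br: "\<And>x y. \<lbrakk>x \<in> H; y \<in> H\<rbrakk> \<Longrightarrow> bracket V x y \<in> H"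
    and tw: "\<And>x. x \<in> H \<Longrightarrow> twist V x \<in> H"
    using assms(2) by (auto simp: hom_lie_subalgebra_def)
  note H = submoduleD[OF sub]
  have "\<exists>y\<in>H. y \<oplus>\<^bsub>V\<^esub> x = \<zero>\<^bsub>V\<^esub>" if "x \<in> H" for x
    using that H V.l_neg[of x] by (intro bexI[of _ "\<ominus>\<^bsub>V\<^esub> x"]) auto
  then interpret H: module K "V\<lparr>carrier := H\<rparr>"
    by (intro moduleI abelian_groupI V.is_cring)
      (auto simp: H V.a_ac V.smult_l_distr V.smult_r_distr V.smult_assoc1)
  \<comment> \<open>The inverse is defined by a description over the carrier, so negation in the
    restricted record has to be identified with negation in \<open>V\<close>.\<close>
  have minus: "\<ominus>\<^bsub>V\<lparr>carrier := H\<rparr>\<^esub> x = \<ominus>\<^bsub>V\<^esub> x" if "x \<in> H" for x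
    using that H H.minus_equality[of "\<ominus>\<^bsub>V\<^esub> x" x] by (simp add: V.l_neg)
  show ?thesis
  proof
    show "linear_map K (V\<lparr>carrier := H\<rparr>) (V\<lparr>carrier := H\<rparr>) (twist (V\<lparr>carrier := H\<rparr>))"
      by (auto simp: linear_map_def tw H)
    show "bilinear_map K (V\<lparr>carrier := H\<rparr>) (V\<lparr>carrier := H\<rparr>) (V\<lparr>carrier := H\<rparr>)
      (bracket (V\<lparr>carrier := H\<rparr>))"
      by (auto simp: bilinear_map_def linear_map_def br H)
    show "bracket (V\<lparr>carrier := H\<rparr>) x y = \<ominus>\<^bsub>V\<lparr>carrier := H\<rparr>\<^esub> bracket (V\<lparr>carrier := H\<rparr>) y x"
      if "x \<in> carrier (V\<lparr>carrier := H\<rparr>)" "y \<in> carrier (V\<lparr>carrier := H\<rparr>)" for x y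
      using that H V.skew[of x y] br by (simp add: minus)
  qed (simp add: V.hom_jacobi H)
qed

lemma hom_lie_prod_simps [simp]:
  "carrier (hom_lie_prod V W) = carrier V \<times> carrier W"
  "\<zero>\<^bsub>hom_lie_prod V W\<^esub> = (\<zero>\<^bsub>V\<^esub>, \<zero>\<^bsub>W\<^esub>)"
  "x \<oplus>\<^bsub>hom_lie_prod V W\<^esub> y = (fst x \<oplus>\<^bsub>V\<^esub> fst y, snd x \<oplus>\<^bsub>W\<^esub> snd y)"
  "a \<odot>\<^bsub>hom_lie_prod V W\<^esub> x = (a \<odot>\<^bsub>V\<^esub> fst x, a \<odot>\<^bsub>W\<^esub> snd x)"
  "bracket (hom_lie_prod V W) x y = (bracket V (fst x) (fst y), bracket W (snd x) (snd y))"
  "twist (hom_lie_prod V W) x = (twist V (fst x), twist W (snd x))"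
  by (simp_all add: hom_lie_prod_def)

lemma
  assumes "hom_lie_algebra K V" "hom_lie_algebra K W"
  shows hom_lie_algebra_prod: "hom_lie_algebra K (hom_lie_prod V W)"
    and minus_prod: "x \<in> carrier V \<times> carrier W \<Longrightarrow>
      \<ominus>\<^bsub>hom_lie_prod V W\<^esub> x = (\<ominus>\<^bsub>V\<^esub> fst x, \<ominus>\<^bsub>W\<^esub> snd x)"
proof -
  interpret V: hom_lie_algebra K V by fact
  interpret W: hom_lie_algebra K W by fact
  interpret P: module K "hom_lie_prod V W"
    by (intro moduleI abelian_groupI V.is_cring)
      (auto simp: V.a_ac V.smult_l_distr V.smult_r_distr V.smult_assoc1
        W.a_ac W.smult_l_distr W.smult_r_distr W.smult_assoc1
        intro!: bexI[of _ "(\<ominus>\<^bsub>V\<^esub> _, \<ominus>\<^bsub>W\<^esub> _)"] V.l_neg W.l_neg)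
  show minus: "\<ominus>\<^bsub>hom_lie_prod V W\<^esub> x = (\<ominus>\<^bsub>V\<^esub> fst x, \<ominus>\<^bsub>W\<^esub> snd x)"
    if "x \<in> carrier V \<times> carrier W" for x
    using that P.minus_equality[of "(\<ominus>\<^bsub>V\<^esub> fst x, \<ominus>\<^bsub>W\<^esub> snd x)" x]
    by (auto simp: V.l_neg W.l_neg)
  show "hom_lie_algebra K (hom_lie_prod V W)"
  proof
    show "linear_map K (hom_lie_prod V W) (hom_lie_prod V W) (twist (hom_lie_prod V W))"
      by (auto simp: linear_map_def)
    show "bilinear_map K (hom_lie_prod V W) (hom_lie_prod V W) (hom_lie_prod V W)
      (bracket (hom_lie_prod V W))"
      by (auto simp: bilinear_map_def linear_map_def)
    show "bracket (hom_lie_prod V W) x y = \<ominus>\<^bsub>hom_lie_prod V W\<^esub> bracket (hom_lie_prod V W) y x"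
      if "x \<in> carrier (hom_lie_prod V W)" "y \<in> carrier (hom_lie_prod V W)" for x y
      using that V.skew[of "fst x" "fst y"] W.skew[of "snd x" "snd y"] by (auto simp: minus)
  qed (auto simp: V.hom_jacobi W.hom_jacobi)
qed

text \<open>The operations of the quotient are unions over representatives.
  \<open>quot_Union\<close> collapses such a union to one representative once the summand is
  constant on the coset. This makes the coset map \<open>q\<close> a surjective homomorphism, and
  \<open>hom_lie_algebra_image\<close> supplies the axioms.\<close>

lemma
  assumes "hom_lie_algebra K V" "hom_lie_ideal K N V"
  defines "q \<equiv> \<lambda>x. N +>\<^bsub>V\<^esub> x"
  shows quot_hom: "hom_lie_hom K V (hom_lie_quot V N) q"
    and quot_carrier: "carrier (hom_lie_quot V N) = q ` carrier V"
    and quot_zero: "\<zero>\<^bsub>hom_lie_quot V N\<^esub> = q \<zero>\<^bsub>V\<^esub>"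
    and quot_eq_iff: "\<lbrakk>x \<in> carrier V; y \<in> carrier V\<rbrakk> \<Longrightarrow> q x = q y \<longleftrightarrow> x \<ominus>\<^bsub>V\<^esub> y \<in> N"
    and quot_Union: "\<And>x g. \<lbrakk>x \<in> carrier V; \<And>n. n \<in> N \<Longrightarrow> g (n \<oplus>\<^bsub>V\<^esub> x) = g x\<rbrakk> \<Longrightarrow>
        (\<Union>y\<in>q x. g y) = g x"
    and quot_self: "x \<in> carrier V \<Longrightarrow> x \<in> q x"
    and quot_algebra: "hom_lie_algebra K (hom_lie_quot V N)"
proof -
  interpret V: hom_lie_algebra K V by fact
  have sub: "submodule N K V" and tw: "\<And>x. x \<in> N \<Longrightarrow> twist V x \<in> N"
    and brl: "\<And>x y. \<lbrakk>x \<in> N; y \<in> carrier V\<rbrakk> \<Longrightarrow> bracket V x y \<in> N"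
    using assms(2) by (auto simp: hom_lie_ideal_def hom_lie_subalgebra_def)
  note N = submoduleD[OF sub]
  \<comment> \<open>The definition of an ideal puts the element of \<open>N\<close> in the first
    slot of the bracket; skew symmetry moves it to the second.\<close>
  have brr: "bracket V y x \<in> N" if "x \<in> N" "y \<in> carrier V" for x y
    using that N V.skew[of y x] brl by simp
  interpret N: abelian_subgroup N V
    using sub by (intro abelian_subgroupI3 additive_subgroupI V.abelian_group_axioms)
      (auto simp: submodule_def)
  have q_def': "q x = (\<lambda>n. n \<oplus>\<^bsub>V\<^esub> x) ` N" for x
    by (auto simp: q_def a_r_coset_def')
  have add_eq: "q (n \<oplus>\<^bsub>V\<^esub> x) = q x" if "n \<in> N" "x \<in> carrier V" for n x
    using that N V.a_repr_independence[of "n \<oplus>\<^bsub>V\<^esub> x" N x] N.a_subgroup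
    by (auto simp: q_def a_r_coset_def')
  show Un: "(\<Union>y\<in>q x. g y) = g x"
    if "x \<in> carrier V" "\<And>n. n \<in> N \<Longrightarrow> g (n \<oplus>\<^bsub>V\<^esub> x) = g x" for x g
  proof -
    have "N \<noteq> {}" using N(2) by blast
    then show ?thesis using that by (auto simp: q_def')
  qed
  show carr: "carrier (hom_lie_quot V N) = q ` carrier V"
    by (auto simp: hom_lie_quot_def A_RCOSETS_def' q_def)
  show zero: "\<zero>\<^bsub>hom_lie_quot V N\<^esub> = q \<zero>\<^bsub>V\<^esub>"
    using N.a_subset by (simp add: hom_lie_quot_def q_def)
  show "x \<in> q x" if "x \<in> carrier V" for x
    using that N.a_rcos_self by (simp add: q_def)
  show "q x = q y \<longleftrightarrow> x \<ominus>\<^bsub>V\<^esub> y \<in> N" if "x \<in> carrier V" "y \<in> carrier V" for x y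
  proof
    assume "q x = q y"
    then have "x \<in> q y" using N.a_rcos_self[OF that(1)] by (simp add: q_def)
    then obtain n where "n \<in> N" "x = n \<oplus>\<^bsub>V\<^esub> y" by (auto simp: q_def')
    then show "x \<ominus>\<^bsub>V\<^esub> y \<in> N"
      using that N(1)[of n] by (simp add: a_minus_def V.a_assoc V.r_neg)
  next
    assume "x \<ominus>\<^bsub>V\<^esub> y \<in> N"
    from add_eq[OF this that(2)] show "q x = q y"
      using that by (simp add: a_minus_def V.a_assoc V.l_neg)
  qed
  show hom: "hom_lie_hom K V (hom_lie_quot V N) q"
    unfolding hom_lie_hom_def linear_map_def
  proof (intro conjI ballI)
    show "q \<in> carrier V \<rightarrow> carrier (hom_lie_quot V N)" by (auto simp: carr)
    fix x assume x: "x \<in> carrier V"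
    show "q (twist V x) = twist (hom_lie_quot V N) (q x)"
      using x by (simp add: hom_lie_quot_def flip: q_def)
        (rule Un[symmetric], auto simp: N add_eq tw)
    show "q (a \<odot>\<^bsub>V\<^esub> x) = a \<odot>\<^bsub>hom_lie_quot V N\<^esub> q x" if "a \<in> carrier K" for a
      using x that by (simp add: hom_lie_quot_def flip: q_def)
        (rule Un[symmetric], auto simp: N add_eq V.smult_r_distr)
    fix y assume y: "y \<in> carrier V"
    show "q (x \<oplus>\<^bsub>V\<^esub> y) = q x \<oplus>\<^bsub>hom_lie_quot V N\<^esub> q y"
      using x y by (simp add: hom_lie_quot_def q_def N.a_rcos_sum)
    \<comment> \<open>The double union is collapsed one variable at a time, first over the right
      factor with the left representative fixed.\<close>
    have "(\<Union>v\<in>q y. q (bracket V u v)) = q (bracket V u y)" if "u \<in> carrier V" for u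
      using that y by (intro Un) (auto simp: N add_eq brr)
    moreover have "q x \<subseteq> carrier V"
      using x by (auto simp: q_def' N(1))
    ultimately have "(\<Union>u\<in>q x. \<Union>v\<in>q y. q (bracket V u v)) = (\<Union>u\<in>q x. q (bracket V u y))"
      by (intro SUP_cong) blast+
    also have "\<dots> = q (bracket V x y)"
      using x y by (intro Un) (auto simp: N add_eq brl)
    finally show "q (bracket V x y) = bracket (hom_lie_quot V N) (q x) (q y)"
      by (simp add: hom_lie_quot_def flip: q_def)
  qed
  show "hom_lie_algebra K (hom_lie_quot V N)"
    by (rule hom_lie_algebra_image[OF assms(1) hom]) (simp_all add: carr zero)
qed

lemma
  assumes "hom_lie_algebra K V" "hom_lie_ideal K N V"
  shows quot_zero_iff: "x \<in> carrier V \<Longrightarrow> N +>\<^bsub>V\<^esub> x = \<zero>\<^bsub>hom_lie_quot V N\<^esub> \<longleftrightarrow> x \<in> N"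
    and quot_add_eq: "\<lbrakk>n \<in> N; x \<in> carrier V\<rbrakk> \<Longrightarrow> N +>\<^bsub>V\<^esub> (n \<oplus>\<^bsub>V\<^esub> x) = N +>\<^bsub>V\<^esub> x"
proof -
  interpret V: hom_lie_algebra K V by fact
  have sub: "submodule N K V"
    using assms(2) by (auto simp: hom_lie_ideal_def hom_lie_subalgebra_def)
  show "N +>\<^bsub>V\<^esub> x = \<zero>\<^bsub>hom_lie_quot V N\<^esub> \<longleftrightarrow> x \<in> N" if "x \<in> carrier V"
    using that quot_eq_iff[OF assms that V.zero_closed] V.minus_equality[of "\<zero>\<^bsub>V\<^esub>" "\<zero>\<^bsub>V\<^esub>"]
    by (simp add: quot_zero[OF assms] a_minus_def)
  show "N +>\<^bsub>V\<^esub> (n \<oplus>\<^bsub>V\<^esub> x) = N +>\<^bsub>V\<^esub> x" if "n \<in> N" "x \<in> carrier V"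
    using that submoduleD(1)[OF sub that(1)]
    by (subst quot_eq_iff[OF assms]) (auto simp: a_minus_def V.a_assoc V.r_neg)
qed

section \<open>Inverses and composites of isomorphisms\<close>

lemma hom_lie_iso_inv:
  assumes "hom_lie_algebra K V" "hom_lie_iso K V W f"
  shows "hom_lie_iso K W V (inv_into (carrier V) f)"
proof -
  interpret V: hom_lie_algebra K V by fact
  have hom: "hom_lie_hom K V W f" and bij: "bij_betw f (carrier V) (carrier W)"
    using assms(2) by (auto simp: hom_lie_iso_def)
  define g where "g = inv_into (carrier V) f"
  note f = hom_lie_homD[OF hom]
  have gf: "g (f x) = x" if "x \<in> carrier V" for x
    using bij that by (simp add: g_def bij_betw_inv_into_left)
  have onto: "\<exists>x\<in>carrier V. u = f x" if "u \<in> carrier W" for u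
    using bij that by (auto simp: bij_betw_def)
  have "hom_lie_hom K W V g"
    unfolding hom_lie_hom_def linear_map_def
  proof (intro conjI ballI funcsetI)
    fix u assume "u \<in> carrier W"
    then obtain x where x: "x \<in> carrier V" "u = f x" using onto by auto
    then show "g u \<in> carrier V" by (simp add: gf)
    show "g (twist W u) = twist V (g u)" using x by (simp flip: f(6) add: gf)
    show "g (a \<odot>\<^bsub>W\<^esub> u) = a \<odot>\<^bsub>V\<^esub> g u" if "a \<in> carrier K" for a
      using x that by (simp flip: f(4) add: gf)
    fix v assume "v \<in> carrier W"
    then obtain y where y: "y \<in> carrier V" "v = f y" using onto by auto
    show "g (u \<oplus>\<^bsub>W\<^esub> v) = g u \<oplus>\<^bsub>V\<^esub> g v" "g (bracket W u v) = bracket V (g u) (g v)"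
      using x y by (simp_all flip: f(3,5) add: gf)
  qed
  then show ?thesis
    using bij by (auto simp: hom_lie_iso_def g_def bij_betw_inv_into)
qed

lemma hom_lie_hom_comp:
  assumes "hom_lie_hom K U V f" "hom_lie_hom K V W g"
  shows "hom_lie_hom K U W (g \<circ> f)"
  using hom_lie_homD[OF assms(1)] hom_lie_homD[OF assms(2)]
  by (auto simp: hom_lie_hom_def[of K U W] linear_map_def[of K U W])

lemma hom_lie_iso_comp:
  assumes "hom_lie_iso K U V f" "hom_lie_iso K V W g"
  shows "hom_lie_iso K U W (g \<circ> f)"
  using assms by (auto simp: hom_lie_iso_def intro: bij_betw_trans hom_lie_hom_comp)

section \<open>Commutators of an action\<close>

lemma act_mem_commutator:
  assumes "l \<in> carrier L" "m \<in> carrier M"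
  shows "\<rho> l (twist M m) \<in> commutator K M L \<rho>"
  unfolding commutator_def by (rule subsetD[OF subset_lin_span]) (use assms in auto)

lemma commutator_subset:
  assumes "submodule W K M"
    and "\<And>l m. \<lbrakk>l \<in> carrier L; m \<in> carrier M\<rbrakk> \<Longrightarrow> \<rho> l (twist M m) \<in> W"
  shows "commutator K M L \<rho> \<subseteq> W"
  unfolding commutator_def using assms by (intro lin_span_subset) auto

text \<open>The twist maps generators to generators, so the preimage of the commutator under the
  twist is a submodule containing all generators, hence the whole commutator. The operation
  \<open>\<rho>\<close> is kept general so that the result serves both for extensions and for the
  fibre product.\<close>

lemma commutator_ideal:
  assumes "hom_lie_algebra K M"
    and act: "\<And>l m. \<lbrakk>l \<in> carrier L; m \<in> carrier M\<rbrakk> \<Longrightarrow> \<rho> l m \<in> carrier M"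
    and twist_act: "\<And>l m. \<lbrakk>l \<in> carrier L; m \<in> carrier M\<rbrakk> \<Longrightarrow>
      twist M (\<rho> l m) = \<rho> (twist L l) (twist M m)"
    and twist: "\<And>l. l \<in> carrier L \<Longrightarrow> twist L l \<in> carrier L"
    and bracket: "\<And>x y. \<lbrakk>x \<in> carrier M; y \<in> carrier M\<rbrakk> \<Longrightarrow> bracket M x y \<in> commutator K M L \<rho>"
  shows "hom_lie_ideal K (commutator K M L \<rho>) M"
proof -
  interpret M: hom_lie_algebra K M by fact
  have sub: "submodule (commutator K M L \<rho>) K M"
    unfolding commutator_def using act by (intro submodule_lin_span M.is_module) auto
  have "commutator K M L \<rho> \<subseteq> {x \<in> carrier M. twist M x \<in> commutator K M L \<rho>}"
    using act twist
    by (intro commutator_subset submodule_vimage[OF M.is_module M.is_module M.twist_linear sub])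
      (auto simp: twist_act intro: act_mem_commutator)
  then show ?thesis
    using sub submoduleD(1)[OF sub] by (auto simp: hom_lie_ideal_def hom_lie_subalgebra_def bracket)
qed

section \<open>Relative central extensions\<close>

context relative_central_extension
begin

sublocale L: hom_lie_algebra K "base E" by (rule base_hom_lie)
sublocale M: hom_lie_algebra K "cover E" by (rule cover_hom_lie)

lemma
  shows act_linear_right: "l \<in> carrier (base E) \<Longrightarrow> linear_map K (cover E) (cover E) (act E l)"
    and act_linear_left: "m \<in> carrier (cover E) \<Longrightarrow>
      linear_map K (base E) (cover E) (\<lambda>l. act E l m)"
    and twist_act: "\<lbrakk>l \<in> carrier (base E); m \<in> carrier (cover E)\<rbrakk> \<Longrightarrow>
      twist (cover E) (act E l m) = act E (twist (base E) l) (twist (cover E) m)"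
    and act_bracket: "\<lbrakk>x \<in> carrier (base E); y \<in> carrier (base E); m \<in> carrier (cover E)\<rbrakk> \<Longrightarrow>
      act E (bracket (base E) x y) (twist (cover E) m) =
        act E (twist (base E) x) (act E y m) \<ominus>\<^bsub>cover E\<^esub> act E (twist (base E) y) (act E x m)"
    and act_derivation:
      "\<lbrakk>x \<in> carrier (base E); m \<in> carrier (cover E); m' \<in> carrier (cover E)\<rbrakk> \<Longrightarrow>
      act E (twist (base E) x) (bracket (cover E) m m') =
        bracket (cover E) (act E x m) (twist (cover E) m') \<oplus>\<^bsub>cover E\<^esub>
        bracket (cover E) (twist (cover E) m) (act E x m')"
  using action by (auto simp: hom_action_def bilinear_map_def)

lemmas act_simps [simp] = linear_mapD[OF act_linear_right] linear_mapD(2,3)[OF act_linear_left]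
lemmas act_zero [simp] = linear_map_zero[OF M.is_module M.is_module act_linear_right]
  linear_map_zero[OF L.is_module M.is_module act_linear_left]
lemmas proj_simps [simp] = hom_lie_homD(2-6)[OF proj_hom]
lemmas proj_zero [simp] = linear_map_zero[OF M.is_module L.is_module hom_lie_homD(1)[OF proj_hom]]

text \<open>By \<open>act_proj\<close> a bracket \<open>[x, y]\<close> is the action of
  \<open>proj E x\<close> on the twist of \<open>y\<close>, hence a generator of the
  commutator.\<close>

lemma ext_commutator_ideal: "hom_lie_ideal K (ext_commutator K E) (cover E)"
proof (rule commutator_ideal)
  show "bracket (cover E) x y \<in> ext_commutator K E"
    if "x \<in> carrier (cover E)" "y \<in> carrier (cover E)" for x y
    using that act_mem_commutator[of "proj E x" "base E" y "cover E" "act E" K] by (simp add: act_proj)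
qed (simp_all add: M.hom_lie_algebra_axioms twist_act)

lemma ext_commutator_submodule: "submodule (ext_commutator K E) K (cover E)"
  using ext_commutator_ideal by (auto simp: hom_lie_ideal_def hom_lie_subalgebra_def)

end

text \<open>In the regular case every element of the cover is a twist, so the twisted argument in
  \<open>proj_act\<close> may be replaced by an arbitrary one.\<close>

lemma (in relative_central_extension) proj_act_regular:
  assumes "regular (cover E)" "l \<in> carrier (base E)" "m \<in> carrier (cover E)"
  shows "proj E (act E l m) = bracket (base E) (twist (base E) l) (proj E m)"
proof -
  obtain m' where "m' \<in> carrier (cover E)" "m = twist (cover E) m'"
    using assms(1,3) unfolding regular_def bij_betw_def by (metis imageE)
  then show ?thesis using proj_act assms(2) by auto
qed

text \<open>The remaining axioms of an extension are again identities, so they descend along a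
  surjection \<open>q\<close> of covers that intertwines projections and actions over a fixed base.
  This reduces quotient extensions to the behaviour of the coset map.\<close>

lemma relative_central_extension_image:
  assumes "relative_central_extension K E"
    and base: "base E' = base E" "base_ideal E' = base_ideal E"
    and hom: "hom_lie_hom K (cover E) (cover E') q"
    and onto: "q ` carrier (cover E) = carrier (cover E')"
    and zero: "q \<zero>\<^bsub>cover E\<^esub> = \<zero>\<^bsub>cover E'\<^esub>"
    and proj: "\<And>x. x \<in> carrier (cover E) \<Longrightarrow> proj E' (q x) = proj E x"
    and act: "\<And>l x. \<lbrakk>l \<in> carrier (base E); x \<in> carrier (cover E)\<rbrakk> \<Longrightarrow> act E' l (q x) = q (act E l x)"
  shows "relative_central_extension K E'"
proof -
  interpret E: relative_central_extension K E by fact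
  note q = hom_lie_homD[OF hom]
  interpret Q: hom_lie_algebra K "cover E'"
    by (rule hom_lie_algebra_image[OF E.cover_hom_lie hom onto zero])
  note diff = linear_map_diff[OF E.M.is_module Q.is_module q(1)]
  have ex: "\<exists>x\<in>carrier (cover E). u = q x" if "u \<in> carrier (cover E')" for u
    using that onto by auto
  show ?thesis
  proof (rule relative_central_extension.intro)
    show "proj E' ` carrier (cover E') = base_ideal E'"
      unfolding base E.proj_image[symmetric] onto[symmetric] image_image
      by (rule image_cong) (simp_all add: proj)
    show "hom_lie_hom K (cover E') (base E') (proj E')"
      unfolding hom_lie_hom_def linear_map_def base
    proof (intro conjI ballI funcsetI)
      fix u assume "u \<in> carrier (cover E')"
      then obtain x where x: "x \<in> carrier (cover E)" "u = q x" using ex by auto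
      then show "proj E' u \<in> carrier (base E)" by (simp add: proj)
      show "proj E' (twist (cover E') u) = twist (base E) (proj E' u)"
        using x by (simp flip: q(6) add: proj)
      show "proj E' (a \<odot>\<^bsub>cover E'\<^esub> u) = a \<odot>\<^bsub>base E\<^esub> proj E' u" if "a \<in> carrier K" for a
        using x that by (simp flip: q(4) add: proj)
      fix v assume "v \<in> carrier (cover E')"
      then obtain y where y: "y \<in> carrier (cover E)" "v = q y" using ex by auto
      show "proj E' (u \<oplus>\<^bsub>cover E'\<^esub> v) = proj E' u \<oplus>\<^bsub>base E\<^esub> proj E' v"
        "proj E' (bracket (cover E') u v) = bracket (base E) (proj E' u) (proj E' v)"
        using x y by (simp_all flip: q(3,5) add: proj)
    qed
    show "hom_action K (base E') (cover E') (act E')"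
      unfolding hom_action_def bilinear_map_def linear_map_def base
    proof (intro conjI ballI funcsetI)
      fix l u assume l: "l \<in> carrier (base E)" and "u \<in> carrier (cover E')"
      then obtain x where x: "x \<in> carrier (cover E)" "u = q x" using ex by auto
      then show "act E' l u \<in> carrier (cover E')" "act E' l u \<in> carrier (cover E')"
        using l by (simp_all add: act q(2))
      show "twist (cover E') (act E' l u) = act E' (twist (base E) l) (twist (cover E') u)"
        using l x by (simp flip: q(6) add: act E.twist_act)
      show "act E' l (a \<odot>\<^bsub>cover E'\<^esub> u) = a \<odot>\<^bsub>cover E'\<^esub> act E' l u" if "a \<in> carrier K" for a
        using l x that by (simp flip: q(4) add: act)
      show "act E' (a \<odot>\<^bsub>base E\<^esub> l) u = a \<odot>\<^bsub>cover E'\<^esub> act E' l u" if "a \<in> carrier K" for a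
        using l x that by (simp flip: q(4) add: act)
      show "act E' (l \<oplus>\<^bsub>base E\<^esub> l') u = act E' l u \<oplus>\<^bsub>cover E'\<^esub> act E' l' u"
        "act E' (bracket (base E) l l') (twist (cover E') u) =
          act E' (twist (base E) l) (act E' l' u) \<ominus>\<^bsub>cover E'\<^esub>
          act E' (twist (base E) l') (act E' l u)"
        if "l' \<in> carrier (base E)" for l'
        using l x that by (simp_all flip: q(3,6) diff add: act E.act_bracket)
      fix v assume "v \<in> carrier (cover E')"
      then obtain y where y: "y \<in> carrier (cover E)" "v = q y" using ex by auto
      show "act E' l (u \<oplus>\<^bsub>cover E'\<^esub> v) = act E' l u \<oplus>\<^bsub>cover E'\<^esub> act E' l v"
        "act E' (twist (base E) l) (bracket (cover E') u v) =
          bracket (cover E') (act E' l u) (twist (cover E') v) \<oplus>\<^bsub>cover E'\<^esub>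
          bracket (cover E') (twist (cover E') u) (act E' l v)"
        using l x y by (simp_all flip: q(3,5,6) add: act E.act_derivation)
    qed
    show "proj E' (act E' l (twist (cover E') u)) =
        bracket (base E') (twist (base E') l) (proj E' (twist (cover E') u))"
      if "l \<in> carrier (base E')" "u \<in> carrier (cover E')" for l u
    proof -
      obtain x where "x \<in> carrier (cover E)" "u = q x" using ex \<open>u \<in> _\<close> by auto
      then show ?thesis
        using \<open>l \<in> _\<close> E.proj_act[of l x] by (simp flip: q(6) add: act proj base)
    qed
    show "act E' (proj E' v) (twist (cover E') u) = bracket (cover E') v u"
      if "u \<in> carrier (cover E')" "v \<in> carrier (cover E')" for u v
    proof -
      obtain x y where "x \<in> carrier (cover E)" "u = q x" "y \<in> carrier (cover E)" "v = q y"
        using ex[OF \<open>u \<in> _\<close>] ex[OF \<open>v \<in> _\<close>] by blast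
      then show ?thesis
        by (simp flip: q(5,6) add: act proj E.act_proj)
    qed
  qed (simp_all add: base E.base_hom_lie E.ideal Q.hom_lie_algebra_axioms)
qed

text \<open>The action has second coordinate zero, so \<open>act_proj\<close> forces brackets in the
  product to have second coordinate zero as well; this is where \<open>A\<close> must be
  abelian.\<close>

lemma relative_central_extension_prod:
  assumes "relative_central_extension K E" "hom_lie_algebra K A"
    and abelian: "\<And>a b. \<lbrakk>a \<in> carrier A; b \<in> carrier A\<rbrakk> \<Longrightarrow> bracket A a b = \<zero>\<^bsub>A\<^esub>"
  shows "relative_central_extension K (prod_ext E A)"
proof -
  interpret E: relative_central_extension K E by fact
  interpret A: hom_lie_algebra K A by fact
  have minus: "x \<ominus>\<^bsub>hom_lie_prod (cover E) A\<^esub> y = (fst x \<ominus>\<^bsub>cover E\<^esub> fst y, snd x \<ominus>\<^bsub>A\<^esub> snd y)"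
    if "y \<in> carrier (cover E) \<times> carrier A" for x y
    by (simp add: a_minus_def minus_prod[OF E.cover_hom_lie assms(2) that])
  have im: "(\<lambda>x. proj E (fst x)) ` (carrier (cover E) \<times> carrier A) = base_ideal E"
    unfolding E.proj_image[symmetric] using A.zero_closed by force
  show ?thesis
  proof (rule relative_central_extension.intro)
    show "hom_lie_hom K (cover (prod_ext E A)) (base (prod_ext E A)) (proj (prod_ext E A))"
      by (auto simp: prod_ext_def hom_lie_hom_def linear_map_def)
    show "hom_action K (base (prod_ext E A)) (cover (prod_ext E A)) (act (prod_ext E A))"
      by (auto simp: prod_ext_def hom_action_def bilinear_map_def linear_map_def minus
          E.act_bracket E.act_derivation E.twist_act A.M.minus_eq A.M.r_neg)
  qed (auto simp: prod_ext_def im E.base_hom_lie E.ideal E.proj_act[simplified] E.act_proj abelian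
      hom_lie_algebra_prod[OF E.cover_hom_lie assms(2)])
qed

text \<open>The projection is constant on a coset because \<open>N\<close> lies in the kernel. The
  action respects cosets because changing a representative by \<open>n\<close> changes the result by
  \<open>act E l n\<close>, which \<open>stable\<close> keeps in \<open>N\<close>. The axioms then
  descend along the coset map.\<close>

lemma
  assumes "relative_central_extension K E" and N: "hom_lie_ideal K N (cover E)" "N \<subseteq> ext_kernel E"
    and stable: "\<And>l n. \<lbrakk>l \<in> carrier (base E); n \<in> N\<rbrakk> \<Longrightarrow> act E l n \<in> N"
  defines "q \<equiv> \<lambda>x. N +>\<^bsub>cover E\<^esub> x"
  shows relative_central_extension_quot: "relative_central_extension K (quot_ext E N)"
    and proj_quot: "x \<in> carrier (cover E) \<Longrightarrow> proj (quot_ext E N) (q x) = proj E x"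
    and act_quot: "\<lbrakk>l \<in> carrier (base E); x \<in> carrier (cover E)\<rbrakk> \<Longrightarrow>
      act (quot_ext E N) l (q x) = q (act E l x)"
proof -
  interpret E: relative_central_extension K E by fact
  note quot = quot_hom[OF E.cover_hom_lie N(1), folded q_def]
    quot_carrier[OF E.cover_hom_lie N(1), folded q_def]
    quot_zero[OF E.cover_hom_lie N(1), folded q_def]
  have NM: "n \<in> carrier (cover E)" and ker: "proj E n = \<zero>\<^bsub>base E\<^esub>" if "n \<in> N" for n
    using that N(2) by (auto simp: a_kernel_def kernel_def)
  show proj: "proj (quot_ext E N) (q x) = proj E x" if "x \<in> carrier (cover E)" for x
  proof -
    have "proj E ` q x = {proj E x}"
      using that quot_self[OF E.cover_hom_lie N(1) that]
      by (auto simp: q_def a_r_coset_def' NM ker)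
    then show ?thesis by (simp add: quot_ext_def)
  qed
  show act: "act (quot_ext E N) l (q x) = q (act E l x)"
    if l: "l \<in> carrier (base E)" and x: "x \<in> carrier (cover E)" for l x
  proof -
    have "(\<Union>y\<in>q x. q (act E l y)) = q (act E l x)"
      unfolding q_def
    proof (rule quot_Union[OF E.cover_hom_lie N(1) x])
      fix n assume n: "n \<in> N"
      have "act E l (n \<oplus>\<^bsub>cover E\<^esub> x) \<ominus>\<^bsub>cover E\<^esub> act E l x = act E l n"
        using l x NM[OF n] by (simp add: a_minus_def E.M.a_assoc E.M.r_neg)
      then show "N +>\<^bsub>cover E\<^esub> act E l (n \<oplus>\<^bsub>cover E\<^esub> x) = N +>\<^bsub>cover E\<^esub> act E l x"
        using l x NM[OF n] stable[OF l n]
        by (subst quot_eq_iff[OF E.cover_hom_lie N(1)]) auto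
    qed
    then show ?thesis by (simp add: quot_ext_def q_def)
  qed
  show "relative_central_extension K (quot_ext E N)"
    by (rule relative_central_extension_image[OF assms(1), of _ q])
      (use quot proj act in \<open>auto simp: quot_ext_def\<close>)
qed

section \<open>Isoclinisms\<close>

context
  fixes K E E' \<gamma>
  assumes E: "relative_central_extension K E" and E': "relative_central_extension K E'"
    and regular: "regular (base E')" and hom: "hom_lie_hom K (base E) (base E') \<gamma>"
begin

interpretation E: relative_central_extension K E by (rule E)
interpretation E': relative_central_extension K E' by (rule E')

text \<open>As \<gamma> commutes with the twists and the twist of \<open>base E'\<close> is
  injective, twists can be cancelled. This simplifies the side conditions in
  \<open>isoclinism\<close> and the defining condition of the fibre product.\<close>

lemma twist_compatible_iff:
  assumes "l \<in> carrier (base E)" "l' \<in> carrier (base E')"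
  shows "\<gamma> (twist (base E) l) = twist (base E') l' \<longleftrightarrow> l' = \<gamma> l"
  using regular assms hom_lie_homD[OF hom]
  by (auto simp: regular_def bij_betw_def dest: inj_onD)

lemma proj_compatible_iff:
  assumes "m \<in> carrier (cover E)" "m' \<in> carrier (cover E')"
  shows "\<gamma> (proj E (twist (cover E) m)) = proj E' (twist (cover E') m') \<longleftrightarrow> \<gamma> (proj E m) = proj E' m'"
  using assms twist_compatible_iff[of "proj E m" "proj E' m'"] by auto

text \<open>The identity \<open>act\<close> on generators carries everything: with surjectivity of
  \<gamma> and of the projections onto the base ideals it shows that \<beta> maps generators onto
  generators, hence commutator onto commutator by \<open>lin_span_image\<close>. The restriction of
  the injective \<beta> is then the required isomorphism of commutators.\<close>

lemma isoclinic_monoI: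
  assumes bij: "bij_betw \<gamma> (carrier (base E)) (carrier (base E'))"
    and ideal: "\<gamma> ` base_ideal E = base_ideal E'"
    and \<beta>: "hom_lie_hom K (cover E) (cover E') \<beta>" and inj: "inj_on \<beta> (carrier (cover E))"
    and proj: "\<And>m. m \<in> carrier (cover E) \<Longrightarrow> \<gamma> (proj E m) = proj E' (\<beta> m)"
    and act: "\<And>l m m'. \<lbrakk>l \<in> carrier (base E); m \<in> carrier (cover E); m' \<in> carrier (cover E');
      \<gamma> (proj E m) = proj E' m'\<rbrakk> \<Longrightarrow> \<beta> (act E l (twist (cover E) m)) = act E' (\<gamma> l) (twist (cover E') m')"
  shows "isoclinic_mono K E E' \<gamma> \<beta>"
proof -
  let ?S = "{act E l (twist (cover E) m) | l m. l \<in> carrier (base E) \<and> m \<in> carrier (cover E)}"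
  let ?S' = "{act E' l (twist (cover E') m) | l m. l \<in> carrier (base E') \<and> m \<in> carrier (cover E')}"
  note b = hom_lie_homD[OF \<beta>] and g = hom_lie_homD[OF hom]
  have "\<beta> ` ?S = ?S'"
  proof
    show "\<beta> ` ?S \<subseteq> ?S'"
    proof safe
      fix l m assume "l \<in> carrier (base E)" "m \<in> carrier (cover E)"
      then show "\<exists>l' m'. \<beta> (act E l (twist (cover E) m)) = act E' l' (twist (cover E') m') \<and>
          l' \<in> carrier (base E') \<and> m' \<in> carrier (cover E')"
        by (intro exI[of _ "\<gamma> l"] exI[of _ "\<beta> m"]) (auto simp: act proj b g)
    qed
    show "?S' \<subseteq> \<beta> ` ?S"
    proof safe
      fix l' m' assume l': "l' \<in> carrier (base E')" and m': "m' \<in> carrier (cover E')"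
      from l' obtain l where l: "l \<in> carrier (base E)" "l' = \<gamma> l"
        using bij by (auto simp: bij_betw_def)
      \<comment> \<open>The base ideal of \<open>E'\<close> is the \<gamma>-image of that of
        \<open>E\<close>, which is the image of \<open>proj E\<close>; this yields a partner
        \<open>m\<close> of \<open>m'\<close>.\<close>
      have "proj E' m' \<in> \<gamma> ` proj E ` carrier (cover E)"
        using m' by (simp add: E.proj_image ideal flip: E'.proj_image)
      then obtain m where m: "m \<in> carrier (cover E)" "\<gamma> (proj E m) = proj E' m'" by auto
      show "act E' l' (twist (cover E') m') \<in> \<beta> ` ?S"
        unfolding l(2) act[OF l(1) m(1) m' m(2), symmetric]
        using l(1) m(1) by (intro imageI) auto
    qed
  qed
  then have im: "\<beta> ` ext_commutator K E = ext_commutator K E'"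
    unfolding commutator_def
    by (subst lin_span_image[OF E.M.is_module E'.M.is_module b(1)]) auto
  note sub = submoduleD(1)[OF E.ext_commutator_submodule]
  have "bij_betw \<beta> (ext_commutator K E) (ext_commutator K E')"
    using im inj sub by (auto simp: bij_betw_def intro: inj_on_subset)
  moreover have "hom_lie_hom K (cover E\<lparr>carrier := ext_commutator K E\<rparr>)
      (cover E'\<lparr>carrier := ext_commutator K E'\<rparr>) \<beta>"
    unfolding hom_lie_hom_def linear_map_def using im by (auto simp: b sub)
  ultimately have "hom_lie_iso K (cover E\<lparr>carrier := ext_commutator K E\<rparr>)
      (cover E'\<lparr>carrier := ext_commutator K E'\<rparr>) \<beta>"
    by (simp add: hom_lie_iso_def)
  then have "isoclinism K E E' \<gamma> \<beta>"
    using hom bij ideal act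
    by (auto simp: isoclinism_def hom_lie_iso_def[of K "base E"] twist_compatible_iff
        proj_compatible_iff)
  then show ?thesis
    using E E' hom ideal \<beta> im inj proj by (simp add: isoclinic_mono_def ext_morphism_def)
qed

end

section \<open>From a common target back to an isoclinism\<close>

lemma induces_isoclinism_if_isoclinic_monos:
  assumes mono1: "isoclinic_mono K E1 Q \<gamma>1 \<beta>1" and mono2: "isoclinic_mono K E2 Q \<gamma>2 \<beta>2"
    and \<gamma>: "hom_lie_iso K (base E1) (base E2) \<gamma>" "\<gamma> ` base_ideal E1 = base_ideal E2"
    and eq: "\<And>l. l \<in> carrier (base E1) \<Longrightarrow> \<gamma>1 l = \<gamma>2 (\<gamma> l)"
  shows "induces_isoclinism K E1 E2 \<gamma>"
proof -
  let ?C1 = "cover E1\<lparr>carrier := ext_commutator K E1\<rparr>"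
  let ?C2 = "cover E2\<lparr>carrier := ext_commutator K E2\<rparr>"
  let ?CQ = "cover Q\<lparr>carrier := ext_commutator K Q\<rparr>"
  interpret E1: relative_central_extension K E1
    using mono1 by (simp add: isoclinic_mono_def ext_morphism_def)
  interpret E2: relative_central_extension K E2
    using mono2 by (simp add: isoclinic_mono_def ext_morphism_def)
  interpret Q: relative_central_extension K Q
    using mono2 by (simp add: isoclinic_mono_def ext_morphism_def)
  have iso: "hom_lie_iso K ?C1 ?CQ \<beta>1" "hom_lie_iso K ?C2 ?CQ \<beta>2"
    and hom: "hom_lie_hom K (cover E2) (cover Q) \<beta>2" "hom_lie_hom K (base E2) (base Q) \<gamma>2"
    and proj: "\<And>m. m \<in> carrier (cover E2) \<Longrightarrow> \<gamma>2 (proj E2 m) = proj Q (\<beta>2 m)"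
    and act1: "\<And>m l m' l'. \<lbrakk>m \<in> carrier (cover E1); l \<in> carrier (base E1); m' \<in> carrier (cover Q);
      l' \<in> carrier (base Q); \<gamma>1 (proj E1 (twist (cover E1) m)) = proj Q (twist (cover Q) m');
      \<gamma>1 (twist (base E1) l) = twist (base Q) l'\<rbrakk> \<Longrightarrow>
      \<beta>1 (act E1 l (twist (cover E1) m)) = act Q l' (twist (cover Q) m')"
    and act2: "\<And>m l m' l'. \<lbrakk>m \<in> carrier (cover E2); l \<in> carrier (base E2); m' \<in> carrier (cover Q);
      l' \<in> carrier (base Q); \<gamma>2 (proj E2 (twist (cover E2) m)) = proj Q (twist (cover Q) m');
      \<gamma>2 (twist (base E2) l) = twist (base Q) l'\<rbrakk> \<Longrightarrow>
      \<beta>2 (act E2 l (twist (cover E2) m)) = act Q l' (twist (cover Q) m')"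
    using mono1 mono2 by (simp_all add: isoclinic_mono_def isoclinism_def ext_morphism_def)
  have "hom_lie_algebra K ?C2"
    using E2.ext_commutator_ideal
    by (intro hom_lie_algebra_subalgebra E2.cover_hom_lie) (simp add: hom_lie_ideal_def)
  note inv = hom_lie_iso_inv[OF this iso(2)]
  define \<beta>' where "\<beta>' = inv_into (ext_commutator K E2) \<beta>2 \<circ> \<beta>1"
  note b = hom_lie_homD[OF hom(1)] and g = hom_lie_homD[OF hom(2)]
  have "hom_lie_iso K ?C1 ?C2 \<beta>'"
    using hom_lie_iso_comp[OF iso(1) inv] by (simp add: \<beta>'_def)
  moreover have "\<beta>' (act E1 l (twist (cover E1) m)) = act E2 l' (twist (cover E2) m')"
    if m: "m \<in> carrier (cover E1)" and l: "l \<in> carrier (base E1)"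
      and m': "m' \<in> carrier (cover E2)" and l': "l' \<in> carrier (base E2)"
      and mm: "\<gamma> (proj E1 (twist (cover E1) m)) = proj E2 (twist (cover E2) m')"
      and ll: "\<gamma> (twist (base E1) l) = twist (base E2) l'" for m l m' l'
  proof -
    \<comment> \<open>Both action values are compared in \<open>Q\<close> with the action of
      \<open>\<gamma>2 l'\<close> on the twist of \<open>\<beta>2 m'\<close>. This element is a
      partner of \<open>m'\<close> and \<open>l'\<close> over \<open>\<gamma>2\<close> and, since
      \<open>\<gamma>1\<close> is \<open>\<gamma>2\<close> after \<gamma>, also of \<open>m\<close>
      and \<open>l\<close> over \<open>\<gamma>1\<close>, so both isoclinisms apply to it.\<close>
    have "proj Q (twist (cover Q) (\<beta>2 m')) = \<gamma>2 (proj E2 (twist (cover E2) m'))"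
      using m' by (simp add: proj b(6) del: E2.proj_simps)
    moreover have "\<gamma>1 (proj E1 (twist (cover E1) m)) = \<gamma>2 (proj E2 (twist (cover E2) m'))"
      using m mm eq by (simp del: E1.proj_simps(5))
    moreover have "\<gamma>1 (twist (base E1) l) = twist (base Q) (\<gamma>2 l')"
      using l l' ll eq by (simp add: g(6))
    ultimately have "\<beta>1 (act E1 l (twist (cover E1) m)) = \<beta>2 (act E2 l' (twist (cover E2) m'))"
      using act1[OF m l b(2)[OF m'] g(2)[OF l']] act2[OF m' l' b(2)[OF m'] g(2)[OF l']] g(6)[OF l']
      by simp
    moreover have "inj_on \<beta>2 (ext_commutator K E2)"
      using iso(2) by (simp add: hom_lie_iso_def bij_betw_def)
    ultimately show ?thesis
      using m' l' by (simp add: \<beta>'_def act_mem_commutator inv_into_f_f)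
  qed
  ultimately show ?thesis
    using \<gamma> unfolding induces_isoclinism_def isoclinism_def by (intro exI[of _ \<beta>'] conjI ballI impI)
qed

section \<open>The fibre product\<close>

locale extension_pair =
  E1: relative_central_extension K E1 + E2: relative_central_extension K E2
  for K :: "('k, 'r) ring_scheme"
    and E1 :: "('k, 'l1, 'm1) rel_ext" and E2 :: "('k, 'l2, 'm2) rel_ext" +
  fixes \<gamma> :: "'l1 \<Rightarrow> 'l2"
  assumes regular: "regular (base E1)" "regular (cover E1)" "regular (base E2)" "regular (cover E2)"
    and iso: "hom_lie_iso K (base E1) (base E2) \<gamma>"
    and image_ideal: "\<gamma> ` base_ideal E1 = base_ideal E2"
begin

abbreviation "F \<equiv> fibre_prod E1 E2 \<gamma>"
abbreviation "D \<equiv> commutator K F (base E1) (fibre_act E1 E2 \<gamma>)"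
abbreviation "A \<equiv> fibre_quot K E1 E2 \<gamma>"
abbreviation "cls x \<equiv> D +>\<^bsub>F\<^esub> x"

lemma iso_hom: "hom_lie_hom K (base E1) (base E2) \<gamma>"
  using iso by (simp add: hom_lie_iso_def)

lemma iso_bij: "bij_betw \<gamma> (carrier (base E1)) (carrier (base E2))"
  using iso by (simp add: hom_lie_iso_def)

lemmas iso_simps [simp] = hom_lie_homD(2-6)[OF iso_hom]
lemmas iso_zero [simp] =
  linear_map_zero[OF E1.L.is_module E2.L.is_module hom_lie_homD(1)[OF iso_hom]]

lemma fibre_simps [simp]:
  "\<zero>\<^bsub>F\<^esub> = (\<zero>\<^bsub>cover E1\<^esub>, \<zero>\<^bsub>cover E2\<^esub>)"
  "u \<oplus>\<^bsub>F\<^esub> v = (fst u \<oplus>\<^bsub>cover E1\<^esub> fst v, snd u \<oplus>\<^bsub>cover E2\<^esub> snd v)"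
  "a \<odot>\<^bsub>F\<^esub> u = (a \<odot>\<^bsub>cover E1\<^esub> fst u, a \<odot>\<^bsub>cover E2\<^esub> snd u)"
  "bracket F u v = (bracket (cover E1) (fst u) (fst v), bracket (cover E2) (snd u) (snd v))"
  "twist F u = (twist (cover E1) (fst u), twist (cover E2) (snd u))"
  by (simp_all add: fibre_prod_def)

lemma mem_fibre_iff [simp]:
  "(x, y) \<in> carrier F \<longleftrightarrow>
    x \<in> carrier (cover E1) \<and> y \<in> carrier (cover E2) \<and> \<gamma> (proj E1 x) = proj E2 y"
  using proj_compatible_iff[OF E1.relative_central_extension_axioms
      E2.relative_central_extension_axioms regular(3) iso_hom]
  by (auto simp: fibre_prod_def)

lemma fibre_algebra: "hom_lie_algebra K F"
proof -
  have P: "hom_lie_algebra K (hom_lie_prod (cover E1) (cover E2))"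
    by (rule hom_lie_algebra_prod[OF E1.cover_hom_lie E2.cover_hom_lie])
  have F: "F = hom_lie_prod (cover E1) (cover E2)\<lparr>carrier := carrier F\<rparr>"
    by (simp add: fibre_prod_def)
  interpret P: hom_lie_algebra K "hom_lie_prod (cover E1) (cover E2)" by (rule P)
  have "submodule (carrier F) K (hom_lie_prod (cover E1) (cover E2))"
    by (rule submoduleI_smult[OF P.is_module]) auto
  then have "hom_lie_subalgebra K (carrier F) (hom_lie_prod (cover E1) (cover E2))"
    by (auto simp: hom_lie_subalgebra_def)
  from hom_lie_algebra_subalgebra[OF P this] show ?thesis
    by (simp flip: F)
qed

sublocale F: hom_lie_algebra K F by (rule fibre_algebra)

text \<open>The projection of \<open>y\<close> lies in the base ideal of \<open>E2\<close>, which is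
  the \<gamma>-image of the base ideal of \<open>E1\<close>, and \<open>proj E1\<close> maps onto
  the latter.\<close>

lemma fibre_lift:
  assumes "y \<in> carrier (cover E2)"
  obtains x where "(x, y) \<in> carrier F"
proof -
  have "proj E2 y \<in> \<gamma> ` proj E1 ` carrier (cover E1)"
    using assms by (simp add: E1.proj_image image_ideal flip: E2.proj_image)
  then show thesis using assms that by auto
qed

lemma fibre_lift':
  assumes "x \<in> carrier (cover E1)"
  obtains y where "(x, y) \<in> carrier F"
proof -
  have "\<gamma> (proj E1 x) \<in> proj E2 ` carrier (cover E2)"
    using assms by (simp add: E2.proj_image flip: image_ideal E1.proj_image)
  then show thesis using assms that by auto
qed

text \<open>Cancelling the twist shows that the description in \<open>fibre_act\<close> picks out
  \<open>\<gamma> l\<close>.\<close>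

lemma fibre_act_eq [simp]:
  assumes "l \<in> carrier (base E1)"
  shows "fibre_act E1 E2 \<gamma> l u = (act E1 l (fst u), act E2 (\<gamma> l) (snd u))"
proof -
  have "(THE l2. l2 \<in> carrier (base E2) \<and> \<gamma> (twist (base E1) l) = twist (base E2) l2) = \<gamma> l"
    using assms twist_compatible_iff[OF E1.relative_central_extension_axioms
        E2.relative_central_extension_axioms regular(3) iso_hom]
    by (intro the_equality) auto
  then show ?thesis by (simp add: fibre_act_def)
qed

text \<open>By \<open>proj_act_regular\<close> the two coordinates project to brackets with the
  twists of \<open>l\<close> and \<open>\<gamma> l\<close>, and \<gamma> carries the first bracket
  to the second.\<close>

lemma fibre_act_closed:
  assumes "l \<in> carrier (base E1)" "(x, y) \<in> carrier F"
  shows "(act E1 l x, act E2 (\<gamma> l) y) \<in> carrier F"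
  using assms E1.proj_act_regular[OF regular(2)] E2.proj_act_regular[OF regular(4)] by auto

text \<open>On \<open>F\<close> the projections of \<open>x\<close> and \<open>y\<close> correspond
  under \<gamma>, so a bracket with \<open>(x, y)\<close> on the left is, in both coordinates at
  once, the action of \<open>proj E1 x\<close> on a twist.\<close>

lemma fibre_commutator_ideal: "hom_lie_ideal K D F"
proof (rule commutator_ideal[OF fibre_algebra])
  show "bracket F u v \<in> D" if "u \<in> carrier F" "v \<in> carrier F" for u v
  proof -
    obtain x y x' y' where uv: "u = (x, y)" "v = (x', y')" by fastforce
    with that have "fibre_act E1 E2 \<gamma> (proj E1 x) (twist F v) \<in> D"
      by (intro act_mem_commutator) auto
    then show ?thesis
      using that uv by (simp add: E1.act_proj E2.act_proj)
  qed
qed (auto simp: E1.twist_act E2.twist_act E1.proj_act_regular[OF regular(2)]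
    E2.proj_act_regular[OF regular(4)])

section \<open>The abelian quotient of the fibre product\<close>

lemma fibre_quot_algebra: "hom_lie_algebra K A"
  unfolding fibre_quot_def by (rule quot_algebra[OF fibre_algebra fibre_commutator_ideal])

sublocale A: hom_lie_algebra K A by (rule fibre_quot_algebra)

lemma
  shows cls_hom: "hom_lie_hom K F A (\<lambda>u. cls u)"
    and cls_carrier: "carrier A = (\<lambda>u. cls u) ` carrier F"
    and cls_zero: "cls (\<zero>\<^bsub>cover E1\<^esub>, \<zero>\<^bsub>cover E2\<^esub>) = \<zero>\<^bsub>A\<^esub>"
    and cls_zero_iff: "u \<in> carrier F \<Longrightarrow> cls u = \<zero>\<^bsub>A\<^esub> \<longleftrightarrow> u \<in> D"
  unfolding fibre_quot_def
  using quot_hom[OF fibre_algebra fibre_commutator_ideal] quot_carrier[OF fibre_algebra fibre_commutator_ideal]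
    quot_zero[OF fibre_algebra fibre_commutator_ideal] quot_zero_iff[OF fibre_algebra fibre_commutator_ideal]
  by auto

lemmas cls_simps = hom_lie_homD(2-6)[OF cls_hom]

text \<open>Generators of \<open>D\<close> are actions on twists. Both twists are surjective, and
  cancelling them in the fibre condition shows that \<open>(x, y)\<close> is the twist of a point of
  \<open>F\<close>; hence every action value is a generator.\<close>

lemma cls_act:
  assumes l: "l \<in> carrier (base E1)" and "(x, y) \<in> carrier F"
  shows "cls (act E1 l x, act E2 (\<gamma> l) y) = \<zero>\<^bsub>A\<^esub>"
proof -
  have "x \<in> twist (cover E1) ` carrier (cover E1)" "y \<in> twist (cover E2) ` carrier (cover E2)"
    using assms regular by (simp_all add: regular_def bij_betw_def)
  then obtain x' y' where x': "x' \<in> carrier (cover E1)" "x = twist (cover E1) x'"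
    and y': "y' \<in> carrier (cover E2)" "y = twist (cover E2) y'"
    by blast
  have "(x', y') \<in> carrier F"
    using assms x' y' proj_compatible_iff[OF E1.relative_central_extension_axioms
      E2.relative_central_extension_axioms regular(3) iso_hom x'(1) y'(1)]
    by (simp del: E1.proj_simps(5) E2.proj_simps(5))
  with l have "fibre_act E1 E2 \<gamma> l (twist F (x', y')) \<in> D"
    by (intro act_mem_commutator) auto
  then show ?thesis
    using l fibre_act_closed[OF assms] x' y' by (subst cls_zero_iff) auto
qed

text \<open>A bracket in \<open>F\<close> is a value of the action, by \<open>act_proj\<close> in
  both coordinates, and \<open>cls_act\<close> kills such values.\<close>

lemma fibre_quot_abelian:
  assumes "a \<in> carrier A" "b \<in> carrier A"
  shows "bracket A a b = \<zero>\<^bsub>A\<^esub>"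
proof -
  obtain u v where uv: "u \<in> carrier F" "a = cls u" "v \<in> carrier F" "b = cls v"
    using assms by (auto simp: cls_carrier)
  obtain x y x' y' where xy: "u = (x, y)" "v = (x', y')" by fastforce
  have "cls (act E1 (proj E1 x) (fst (twist F v)), act E2 (\<gamma> (proj E1 x)) (snd (twist F v))) = \<zero>\<^bsub>A\<^esub>"
    using uv(1,3) xy by (intro cls_act) auto
  then have "cls (bracket F u v) = \<zero>\<^bsub>A\<^esub>"
    using uv(1,3) xy by (simp add: E1.act_proj E2.act_proj)
  then show ?thesis
    using uv by (simp add: cls_simps del: fibre_simps)
qed

section \<open>The ideal dividing the product extension\<close>

abbreviation "P \<equiv> prod_ext E1 A"

text \<open>This is the graph of a linear map from the kernel of \<open>proj E1\<close> to
  \<open>A\<close>. Dividing by it makes the coset of \<open>(x, cls (x, y))\<close> depend on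
  \<open>y\<close> alone, because two admissible \<open>x\<close> differ by an element of that
  kernel.\<close>

definition "T = (\<lambda>m. (m, cls (m, \<zero>\<^bsub>cover E2\<^esub>))) ` {m \<in> carrier (cover E1). proj E1 m = \<zero>\<^bsub>base E1\<^esub>}"

lemma prod_extension: "relative_central_extension K P"
  by (rule relative_central_extension_prod[OF E1.relative_central_extension_axioms
        fibre_quot_algebra fibre_quot_abelian])

sublocale P: relative_central_extension K P by (rule prod_extension)

lemma prod_ext_simps [simp]:
  "base P = base E1" "base_ideal P = base_ideal E1" "cover P = hom_lie_prod (cover E1) A"
  "proj P u = proj E1 (fst u)" "act P l u = (act E1 l (fst u), \<zero>\<^bsub>A\<^esub>)"
  by (simp_all add: prod_ext_def)

lemma mem_T_iff:
  "(m, a) \<in> T \<longleftrightarrow> m \<in> carrier (cover E1) \<and> proj E1 m = \<zero>\<^bsub>base E1\<^esub> \<and> a = cls (m, \<zero>\<^bsub>cover E2\<^esub>)"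
  by (auto simp: T_def)

lemma T_kernel: "T \<subseteq> ext_kernel P"
  by (auto simp: T_def a_kernel_def kernel_def cls_simps)

text \<open>For \<open>m\<close> in the kernel, \<open>act E1 l m\<close> stays in the kernel, and
  \<open>cls_act\<close> at \<open>(m, 0)\<close> shows that its class is zero, the second
  coordinate the graph demands.\<close>

lemma T_stable:
  assumes "l \<in> carrier (base E1)" "u \<in> T"
  shows "(act E1 l (fst u), \<zero>\<^bsub>A\<^esub>) \<in> T"
proof -
  obtain m a where u: "u = (m, a)" by fastforce
  then have "cls (act E1 l m, act E2 (\<gamma> l) \<zero>\<^bsub>cover E2\<^esub>) = \<zero>\<^bsub>A\<^esub>"
    using assms by (intro cls_act) (auto simp: mem_T_iff)
  then show ?thesis
    using assms u by (simp add: mem_T_iff E1.proj_act_regular[OF regular(2)])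
qed

lemma T_ideal: "hom_lie_ideal K T (hom_lie_prod (cover E1) A)"
proof -
  have "submodule T K (hom_lie_prod (cover E1) A)"
  proof (rule submoduleI_smult)
    show "module K (hom_lie_prod (cover E1) A)"
      using P.M.is_module by simp
    show "u \<oplus>\<^bsub>hom_lie_prod (cover E1) A\<^esub> v \<in> T" if "u \<in> T" "v \<in> T" for u v
      using that by (cases u; cases v) (simp add: mem_T_iff flip: cls_simps)
    show "a \<odot>\<^bsub>hom_lie_prod (cover E1) A\<^esub> u \<in> T" if "a \<in> carrier K" "u \<in> T" for a u
      using that by (cases u) (simp add: mem_T_iff flip: cls_simps)
  qed (auto simp: T_def cls_simps mem_T_iff cls_zero)
  moreover have "bracket (hom_lie_prod (cover E1) A) u v \<in> T"
    if "u \<in> T" "v \<in> carrier (hom_lie_prod (cover E1) A)" for u v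
  proof -
    obtain m a m' b where uv: "u = (m, a)" "v = (m', b)" by fastforce
    \<comment> \<open>The kernel of \<open>proj E1\<close> is central: by \<open>act_proj\<close> a
      bracket with \<open>m\<close> is an action of \<open>proj E1 m\<close>, which is zero.\<close>
    then have "bracket (cover E1) m m' = \<zero>\<^bsub>cover E1\<^esub>"
      using that E1.act_proj[of m' m] by (simp add: mem_T_iff)
    then show ?thesis
      using that uv by (auto simp: mem_T_iff fibre_quot_abelian cls_simps cls_zero)
  qed
  moreover have "twist (hom_lie_prod (cover E1) A) u \<in> T" if "u \<in> T" for u
    using that by (cases u) (simp add: mem_T_iff flip: cls_simps)
  ultimately show ?thesis
    by (auto simp: hom_lie_ideal_def hom_lie_subalgebra_def T_def cls_simps)
qed

section \<open>The common target of the two embeddings\<close>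

abbreviation "Q \<equiv> quot_ext P T"
abbreviation "q u \<equiv> T +>\<^bsub>cover P\<^esub> u"

lemma T_ideal': "hom_lie_ideal K T (cover P)"
  using T_ideal by simp

lemma T_stable': "\<lbrakk>l \<in> carrier (base P); u \<in> T\<rbrakk> \<Longrightarrow> act P l u \<in> T"
  using T_stable by simp

lemma
  shows quot_extension: "relative_central_extension K Q"
    and base_Q [simp]: "base Q = base E1" "base_ideal Q = base_ideal E1"
    and q_hom: "hom_lie_hom K (hom_lie_prod (cover E1) A) (cover Q) (\<lambda>u. q u)"
    and carrier_Q: "carrier (cover Q) = (\<lambda>u. q u) ` (carrier (cover E1) \<times> carrier A)"
    and proj_q: "\<lbrakk>m \<in> carrier (cover E1); a \<in> carrier A\<rbrakk> \<Longrightarrow> proj Q (q (m, a)) = proj E1 m"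
    and act_q: "\<lbrakk>l \<in> carrier (base E1); m \<in> carrier (cover E1); a \<in> carrier A\<rbrakk> \<Longrightarrow>
      act Q l (q (m, a)) = q (act E1 l m, \<zero>\<^bsub>A\<^esub>)"
    and q_zero_iff: "\<lbrakk>m \<in> carrier (cover E1); a \<in> carrier A\<rbrakk> \<Longrightarrow>
      q (m, a) = \<zero>\<^bsub>cover Q\<^esub> \<longleftrightarrow> (m, a) \<in> T"
    and q_add_eq: "\<lbrakk>n \<in> T; m \<in> carrier (cover E1); a \<in> carrier A\<rbrakk> \<Longrightarrow>
      q (fst n \<oplus>\<^bsub>cover E1\<^esub> m, snd n \<oplus>\<^bsub>A\<^esub> a) = q (m, a)"
proof -
  have cover: "cover Q = hom_lie_quot (cover P) T"
    by (simp add: quot_ext_def del: prod_ext_simps)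
  show "relative_central_extension K Q"
    by (rule relative_central_extension_quot[OF prod_extension T_ideal' T_kernel T_stable'])
  show "base Q = base E1" "base_ideal Q = base_ideal E1"
    by (simp_all add: quot_ext_def)
  show "hom_lie_hom K (hom_lie_prod (cover E1) A) (cover Q) (\<lambda>u. q u)"
    using quot_hom[OF P.cover_hom_lie T_ideal'] cover by simp
  show "carrier (cover Q) = (\<lambda>u. q u) ` (carrier (cover E1) \<times> carrier A)"
    using quot_carrier[OF P.cover_hom_lie T_ideal'] cover by simp
  show "proj Q (q (m, a)) = proj E1 m" if "m \<in> carrier (cover E1)" "a \<in> carrier A" for m a
    using that proj_quot[OF prod_extension T_ideal' T_kernel T_stable', of "(m, a)"] by simp
  show "act Q l (q (m, a)) = q (act E1 l m, \<zero>\<^bsub>A\<^esub>)"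
    if "l \<in> carrier (base E1)" "m \<in> carrier (cover E1)" "a \<in> carrier A" for l m a
    using that act_quot[OF prod_extension T_ideal' T_kernel T_stable', of l "(m, a)"] by simp
  show "q (m, a) = \<zero>\<^bsub>cover Q\<^esub> \<longleftrightarrow> (m, a) \<in> T"
    if "m \<in> carrier (cover E1)" "a \<in> carrier A" for m a
    using that quot_zero_iff[OF P.cover_hom_lie T_ideal', of "(m, a)"] cover by simp
  show "q (fst n \<oplus>\<^bsub>cover E1\<^esub> m, snd n \<oplus>\<^bsub>A\<^esub> a) = q (m, a)"
    if "n \<in> T" "m \<in> carrier (cover E1)" "a \<in> carrier A" for n m a
    using that quot_add_eq[OF P.cover_hom_lie T_ideal', of n "(m, a)"] by simp
qed

lemmas q_simps = hom_lie_homD(2-6)[OF q_hom]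

end

section \<open>Embedding isoclinic extensions\<close>

locale isoclinic_pair = extension_pair +
  fixes \<beta>' assumes isoclinism: "isoclinism K E1 E2 \<gamma> \<beta>'"
begin

section \<open>Injectivity supplied by an isoclinism\<close>

abbreviation "C1 \<equiv> ext_commutator K E1"
abbreviation "C2 \<equiv> ext_commutator K E2"

lemma
  shows \<beta>'_hom: "hom_lie_hom K (cover E1\<lparr>carrier := C1\<rparr>) (cover E2\<lparr>carrier := C2\<rparr>) \<beta>'"
    and \<beta>'_inj: "inj_on \<beta>' C1"
    and \<beta>'_act: "\<lbrakk>l \<in> carrier (base E1); (x, y) \<in> carrier F\<rbrakk> \<Longrightarrow>
      \<beta>' (act E1 l (twist (cover E1) x)) = act E2 (\<gamma> l) (twist (cover E2) y)"
  using isoclinism by (auto simp: isoclinism_def hom_lie_iso_def bij_betw_def)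

lemmas \<beta>'_simps = hom_lie_homD(2-6)[OF \<beta>'_hom, simplified]

lemma \<beta>'_zero_iff:
  assumes "x \<in> C1"
  shows "\<beta>' x = \<zero>\<^bsub>cover E2\<^esub> \<longleftrightarrow> x = \<zero>\<^bsub>cover E1\<^esub>"
proof -
  have alg: "hom_lie_algebra K (cover E1\<lparr>carrier := C1\<rparr>)" "hom_lie_algebra K (cover E2\<lparr>carrier := C2\<rparr>)"
    using E1.ext_commutator_ideal E2.ext_commutator_ideal
    by (auto simp: hom_lie_ideal_def intro: hom_lie_algebra_subalgebra E1.cover_hom_lie E2.cover_hom_lie)
  then have zero: "\<beta>' \<zero>\<^bsub>cover E1\<^esub> = \<zero>\<^bsub>cover E2\<^esub>"
    using linear_map_zero[OF hom_lie_algebra.is_module hom_lie_algebra.is_module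
        hom_lie_homD(1)[OF \<beta>'_hom]] by simp
  then show ?thesis
    using assms inj_onD[OF \<beta>'_inj, of x "\<zero>\<^bsub>cover E1\<^esub>"] submoduleD(2)[OF E1.ext_commutator_submodule]
    by auto
qed

text \<open>The defining identity of an isoclinism says exactly that generators of \<open>D\<close>
  lie on the graph of \<open>\<beta>'\<close> over \<open>C1\<close>. This graph is a submodule, so
  it contains their span.\<close>

lemma commutator_graph: "D \<subseteq> {u \<in> carrier F. fst u \<in> C1 \<and> snd u = \<beta>' (fst u)}"
proof (rule commutator_subset)
  note C1 = submoduleD[OF E1.ext_commutator_submodule]
  show "submodule {u \<in> carrier F. fst u \<in> C1 \<and> snd u = \<beta>' (fst u)} K F"
    using C1 \<beta>'_simps \<beta>'_zero_iff[OF C1(2)]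
    by (intro submoduleI_smult[OF F.is_module]) auto
  show "fibre_act E1 E2 \<gamma> l (twist F u) \<in> {u \<in> carrier F. fst u \<in> C1 \<and> snd u = \<beta>' (fst u)}"
    if "l \<in> carrier (base E1)" "u \<in> carrier F" for l u
    using that fibre_act_closed[of l "fst (twist F u)" "snd (twist F u)"]
    by (cases u) (auto simp: \<beta>'_act intro: act_mem_commutator)
qed

text \<open>A point \<open>(x, 0)\<close> of the graph has \<open>\<beta>' x\<close> equal to zero,
  so injectivity of \<open>\<beta>'\<close> applies.\<close>

lemma cls_injective:
  assumes "(x, \<zero>\<^bsub>cover E2\<^esub>) \<in> carrier F" "cls (x, \<zero>\<^bsub>cover E2\<^esub>) = \<zero>\<^bsub>A\<^esub>"
  shows "x = \<zero>\<^bsub>cover E1\<^esub>"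
proof -
  have "(x, \<zero>\<^bsub>cover E2\<^esub>) \<in> D" using assms by (simp add: cls_zero_iff del: mem_fibre_iff)
  then have "x \<in> C1" "\<beta>' x = \<zero>\<^bsub>cover E2\<^esub>" using commutator_graph by auto
  then show ?thesis by (simp add: \<beta>'_zero_iff)
qed

text \<open>A point \<open>(0, y)\<close> of the graph has \<open>y\<close> equal to the value of
  \<open>\<beta>'\<close> at zero, which is zero.\<close>

lemma cls_injective':
  assumes "(\<zero>\<^bsub>cover E1\<^esub>, y) \<in> carrier F" "cls (\<zero>\<^bsub>cover E1\<^esub>, y) = \<zero>\<^bsub>A\<^esub>"
  shows "y = \<zero>\<^bsub>cover E2\<^esub>"
proof -
  have "(\<zero>\<^bsub>cover E1\<^esub>, y) \<in> D" using assms by (simp add: cls_zero_iff del: mem_fibre_iff)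
  then have "\<zero>\<^bsub>cover E1\<^esub> \<in> C1" "y = \<beta>' \<zero>\<^bsub>cover E1\<^esub>" using commutator_graph by auto
  then show ?thesis by (simp add: \<beta>'_zero_iff)
qed

section \<open>The embedding of the first extension\<close>

lemma isoclinic_mono1: "isoclinic_mono K E1 Q id (\<lambda>m. q (m, \<zero>\<^bsub>A\<^esub>))"
proof -
  interpret Q: relative_central_extension K Q by (rule quot_extension)
  have "hom_lie_hom K (cover E1) (hom_lie_prod (cover E1) A) (\<lambda>m. (m, \<zero>\<^bsub>A\<^esub>))"
    by (auto simp: hom_lie_hom_def linear_map_def)
  from hom_lie_hom_comp[OF this q_hom]
  have hom: "hom_lie_hom K (cover E1) (cover Q) (\<lambda>m. q (m, \<zero>\<^bsub>A\<^esub>))"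
    by (simp add: comp_def)
  have inj: "inj_on (\<lambda>m. q (m, \<zero>\<^bsub>A\<^esub>)) (carrier (cover E1))"
  proof (rule linear_map_inj_on[OF E1.M.is_module Q.M.is_module hom_lie_homD(1)[OF hom]])
    fix m assume "m \<in> carrier (cover E1)" "q (m, \<zero>\<^bsub>A\<^esub>) = \<zero>\<^bsub>cover Q\<^esub>"
    then have "(m, \<zero>\<^bsub>A\<^esub>) \<in> T" by (simp add: q_zero_iff del: prod_ext_simps)
    then show "m = \<zero>\<^bsub>cover E1\<^esub>"
      by (intro cls_injective) (auto simp: mem_T_iff)
  qed
  show ?thesis
  proof (rule isoclinic_monoI[OF E1.relative_central_extension_axioms quot_extension])
    fix l m u
    assume l: "l \<in> carrier (base E1)" and m: "m \<in> carrier (cover E1)" and "u \<in> carrier (cover Q)"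
      and eq: "id (proj E1 m) = proj Q u"
    then obtain n a where n: "n \<in> carrier (cover E1)" "a \<in> carrier A" "u = q (n, a)"
      by (auto simp: carrier_Q simp del: prod_ext_simps)
    \<comment> \<open>\<open>m\<close> and \<open>n\<close> have the same projection, so one
      \<open>y\<close> is a partner of both. The isoclinism then gives both action values the same
      image under \<open>\<beta>'\<close>, and injectivity makes them equal.\<close>
    obtain y where y: "(m, y) \<in> carrier F" using fibre_lift'[OF m] .
    have "(n, y) \<in> carrier F"
      using eq n y by (simp add: proj_q del: prod_ext_simps)
    then have "act E1 l (twist (cover E1) m) = act E1 l (twist (cover E1) n)"
      using l m n y \<beta>'_act[OF l y] \<beta>'_act[OF l, of n y]
      by (intro inj_onD[OF \<beta>'_inj]) (auto intro: act_mem_commutator)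
    moreover have "twist (cover Q) u = q (twist (cover E1) n, twist A a)"
      using n q_simps(5)[of "(n, a)"] by simp
    ultimately show "q (act E1 l (twist (cover E1) m), \<zero>\<^bsub>A\<^esub>) = act Q (id l) (twist (cover Q) u)"
      using l n by (simp add: act_q del: prod_ext_simps)
  qed (use inj hom regular in \<open>auto simp: proj_q hom_lie_hom_def linear_map_def simp del: prod_ext_simps\<close>)
qed

section \<open>The embedding of the second extension\<close>

lemma q_cls_cong:
  assumes "(x, y) \<in> carrier F" "(x', y) \<in> carrier F"
  shows "q (x, cls (x, y)) = q (x', cls (x', y))"
proof -
  let ?d = "x \<ominus>\<^bsub>cover E1\<^esub> x'"
  have d: "?d \<in> carrier (cover E1)" "?d \<oplus>\<^bsub>cover E1\<^esub> x' = x"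
    using assms by (simp_all add: a_minus_def E1.M.a_assoc E1.M.l_neg)
  have "proj E1 x = proj E1 x'"
    \<comment> \<open>Both projections have \<gamma>-image \<open>proj E2 y\<close>, so they agree
      by injectivity of \<gamma>; the difference \<open>?d\<close> therefore lies in the kernel and
      gives an element of \<open>T\<close>.\<close>
    using assms by (intro inj_onD[OF bij_betw_imp_inj_on[OF iso_bij]]) auto
  then have "proj E1 ?d = \<zero>\<^bsub>base E1\<^esub>"
    using assms linear_map_diff[OF E1.M.is_module E1.L.is_module hom_lie_homD(1)[OF E1.proj_hom]]
    by (simp add: a_minus_def E1.L.r_neg)
  then have T: "(?d, cls (?d, \<zero>\<^bsub>cover E2\<^esub>)) \<in> T" and F: "(?d, \<zero>\<^bsub>cover E2\<^esub>) \<in> carrier F"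
    using d by (auto simp: mem_T_iff)
  have "cls (?d, \<zero>\<^bsub>cover E2\<^esub>) \<oplus>\<^bsub>A\<^esub> cls (x', y) = cls (x, y)"
    using assms d by (simp flip: cls_simps(2)[OF F assms(2)])
  then show ?thesis
    using q_add_eq[OF T, of x' "cls (x', y)"] assms cls_simps(1) d by simp
qed

text \<open>An \<open>x\<close> exists by \<open>fibre_lift\<close>, and \<open>q_cls_cong\<close>
  makes the value independent of the choice.\<close>

definition embed2 where
  "embed2 y = (let x = SOME x. (x, y) \<in> carrier F in q (x, cls (x, y)))"

lemma embed2_eq:
  assumes "(x, y) \<in> carrier F"
  shows "embed2 y = q (x, cls (x, y))"
  unfolding embed2_def Let_def 
  by (rule q_cls_cong[OF someI[of "\<lambda>x. (x, y) \<in> carrier F", OF assms] assms])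

text \<open>Any lift may be used in \<open>embed2_eq\<close>. Twists, multiples, sums and brackets
  of lifts are lifts because \<open>F\<close> is closed under these operations, and
  \<open>cls\<close> and \<open>q\<close> are homomorphisms.\<close>

lemma embed2_hom: "hom_lie_hom K (cover E2) (cover Q) embed2"
  unfolding hom_lie_hom_def linear_map_def
proof (intro conjI ballI funcsetI)
  fix y assume "y \<in> carrier (cover E2)"
  then obtain x where x: "(x, y) \<in> carrier F" by (rule fibre_lift)
  let ?u = "(x, cls (x, y))"
  have u: "?u \<in> carrier (hom_lie_prod (cover E1) A)" using x cls_simps(1)[OF x] by simp
  show "embed2 y \<in> carrier (cover Q)"
    unfolding embed2_eq[OF x] by (rule q_simps(1)[OF u])
  show "embed2 (twist (cover E2) y) = twist (cover Q) (embed2 y)"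
    using embed2_eq[of "twist (cover E1) x" "twist (cover E2) y"] F.twist_simps(1)[OF x]
      q_simps(5)[OF u] cls_simps(5)[OF x] embed2_eq[OF x] by simp
  show "embed2 (a \<odot>\<^bsub>cover E2\<^esub> y) = a \<odot>\<^bsub>cover Q\<^esub> embed2 y" if "a \<in> carrier K" for a
    using embed2_eq[of "a \<odot>\<^bsub>cover E1\<^esub> x" "a \<odot>\<^bsub>cover E2\<^esub> y"] F.smult_closed[OF that x]
      q_simps(3)[OF that u] cls_simps(3)[OF that x] embed2_eq[OF x] by simp
  fix y' assume "y' \<in> carrier (cover E2)"
  then obtain x' where x': "(x', y') \<in> carrier F" by (rule fibre_lift)
  let ?v = "(x', cls (x', y'))"
  have v: "?v \<in> carrier (hom_lie_prod (cover E1) A)" using x' cls_simps(1)[OF x'] by simp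
  show "embed2 (y \<oplus>\<^bsub>cover E2\<^esub> y') = embed2 y \<oplus>\<^bsub>cover Q\<^esub> embed2 y'"
    using embed2_eq[of "x \<oplus>\<^bsub>cover E1\<^esub> x'" "y \<oplus>\<^bsub>cover E2\<^esub> y'"] F.add.m_closed[OF x x']
      q_simps(2)[OF u v] cls_simps(2)[OF x x'] embed2_eq[OF x] embed2_eq[OF x'] by simp
  show "embed2 (bracket (cover E2) y y') = bracket (cover Q) (embed2 y) (embed2 y')"
    using embed2_eq[of "bracket (cover E1) x x'" "bracket (cover E2) y y'"]
      F.bracket_simps(1)[OF x x'] q_simps(4)[OF u v] cls_simps(4)[OF x x']
      embed2_eq[OF x] embed2_eq[OF x'] by simp
qed

lemma isoclinic_mono2:
  "isoclinic_mono K E2 Q (inv_into (carrier (base E1)) \<gamma>) embed2"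
proof -
  interpret Q: relative_central_extension K Q by (rule quot_extension)
  let ?\<delta> = "inv_into (carrier (base E1)) \<gamma>"
  have inv: "hom_lie_iso K (base E2) (base E1) ?\<delta>"
    by (rule hom_lie_iso_inv[OF E1.base_hom_lie iso])
  have \<delta>: "?\<delta> (\<gamma> l) = l" if "l \<in> carrier (base E1)" for l
    using bij_betw_inv_into_left[OF iso_bij that] .
  have ideal: "?\<delta> ` base_ideal E2 = base_ideal E1"
    unfolding image_ideal[symmetric] E1.proj_image[symmetric] image_image
    by (rule image_cong) (simp_all add: \<delta>)
  have proj: "?\<delta> (proj E2 y) = proj Q (embed2 y)" if "y \<in> carrier (cover E2)" for y
  proof -
    obtain x where x: "(x, y) \<in> carrier F" using \<open>y \<in> _\<close> by (rule fibre_lift)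
    then show ?thesis
      using cls_simps(1)[OF x] \<delta>[of "proj E1 x"]
      by (simp add: embed2_eq[OF x] proj_q del: prod_ext_simps)
  qed
  have inj: "inj_on embed2 (carrier (cover E2))"
  proof (rule linear_map_inj_on[OF E2.M.is_module Q.M.is_module hom_lie_homD(1)[OF embed2_hom]])
    fix y assume y: "y \<in> carrier (cover E2)" and zero: "embed2 y = \<zero>\<^bsub>cover Q\<^esub>"
    obtain x where x: "(x, y) \<in> carrier F" using y by (rule fibre_lift)
    then have "(x, cls (x, y)) \<in> T"
      using zero cls_simps(1)[OF x] q_zero_iff[of x "cls (x, y)"] unfolding embed2_eq[OF x] by simp
    then have x0: "proj E1 x = \<zero>\<^bsub>base E1\<^esub>" and eq: "cls (x, y) = cls (x, \<zero>\<^bsub>cover E2\<^esub>)"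
      by (auto simp: mem_T_iff)
    \<comment> \<open>Since \<open>x\<close> projects to zero, so does \<open>y\<close>, and
      \<open>(x, y)\<close> splits inside \<open>F\<close> as \<open>(x, 0)\<close> plus
      \<open>(0, y)\<close>. Membership in \<open>T\<close> then leaves \<open>(0, y)\<close> with
      class zero.\<close>
    have F: "(x, \<zero>\<^bsub>cover E2\<^esub>) \<in> carrier F" "(\<zero>\<^bsub>cover E1\<^esub>, y) \<in> carrier F"
      using x x0 by auto
    have "cls (x, y) = cls (x, \<zero>\<^bsub>cover E2\<^esub>) \<oplus>\<^bsub>A\<^esub> cls (\<zero>\<^bsub>cover E1\<^esub>, y)"
      using x by (simp flip: cls_simps(2)[OF F])
    then have "cls (\<zero>\<^bsub>cover E1\<^esub>, y) = \<zero>\<^bsub>A\<^esub>"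
      using cls_simps(1)[OF F(1)] cls_simps(1)[OF F(2)] eq by (simp add: A.M.add.r_cancel_one')
    with F(2) show "y = \<zero>\<^bsub>cover E2\<^esub>" by (rule cls_injective')
  qed
  show ?thesis
  proof (rule isoclinic_monoI[OF E2.relative_central_extension_axioms quot_extension])
    show "bij_betw ?\<delta> (carrier (base E2)) (carrier (base Q))" "hom_lie_hom K (base E2) (base Q) ?\<delta>"
      using inv by (auto simp: hom_lie_iso_def)
    fix l m u
    assume l': "l \<in> carrier (base E2)" and m: "m \<in> carrier (cover E2)" and "u \<in> carrier (cover Q)"
      and eq: "?\<delta> (proj E2 m) = proj Q u"
    then obtain n a where n: "n \<in> carrier (cover E1)" "a \<in> carrier A" "u = q (n, a)"
      by (auto simp: carrier_Q simp del: prod_ext_simps)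
    obtain x where x: "(x, m) \<in> carrier F" using m by (rule fibre_lift)
    have "proj E1 x = proj E1 n"
      using eq n x \<delta>[of "proj E1 x"] by (simp add: proj_q del: prod_ext_simps)
    \<comment> \<open>The first coordinate \<open>n\<close> of a representative of \<open>u\<close>
      is itself a lift of \<open>m\<close>, so \<open>embed2\<close> at the action value can be
      computed with it. The class occurring there vanishes by \<open>cls_act\<close>, matching the
      zero second coordinate of the action on \<open>Q\<close>.\<close>
    then have F: "(n, m) \<in> carrier F" using x n by simp
    obtain l1 where l1: "l1 \<in> carrier (base E1)" "l = \<gamma> l1"
      using iso l' by (auto simp: hom_lie_iso_def bij_betw_def)
    have tF: "(twist (cover E1) n, twist (cover E2) m) \<in> carrier F"
      using F.twist_simps(1)[OF F] by simp
    note aF = fibre_act_closed[OF l1(1) tF] cls_act[OF l1(1) tF]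
    have "twist (cover Q) u = q (twist (cover E1) n, twist A a)"
      using n q_simps(5)[of "(n, a)"] by simp
    then show "embed2 (act E2 l (twist (cover E2) m)) = act Q (?\<delta> l) (twist (cover Q) u)"
      unfolding l1(2) embed2_eq[OF aF(1)] aF(2) \<delta>[OF l1(1)]
      using l1 n by (simp add: act_q del: prod_ext_simps)
  qed (use inj embed2_hom regular ideal proj in auto)
qed

end

theorem proposition2p6:
  fixes K :: "('k, 'r) ring_scheme"
    and E1 :: "('k, 'l1, 'm1) rel_ext"
    and E2 :: "('k, 'l2, 'm2) rel_ext"
    and \<gamma> :: "'l1 \<Rightarrow> 'l2"
  assumes "relative_central_extension K E1" "regular (base E1)" "regular (cover E1)"
    and "relative_central_extension K E2" "regular (base E2)" "regular (cover E2)"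
    and "hom_lie_iso K (base E1) (base E2) \<gamma>"
    and "\<gamma> ` base_ideal E1 = base_ideal E2"
  shows "induces_isoclinism K E1 E2 \<gamma> \<longleftrightarrow>
    (\<exists>T. hom_lie_ideal K T (hom_lie_prod (cover E1) (fibre_quot K E1 E2 \<gamma>)) \<and>
         T \<subseteq> ext_kernel (prod_ext E1 (fibre_quot K E1 E2 \<gamma>)) \<and>
         (\<exists>\<gamma>1 \<beta>1 \<gamma>2 \<beta>2.
            isoclinic_mono K E1 (quot_ext (prod_ext E1 (fibre_quot K E1 E2 \<gamma>)) T) \<gamma>1 \<beta>1 \<and>
            isoclinic_mono K E2 (quot_ext (prod_ext E1 (fibre_quot K E1 E2 \<gamma>)) T) \<gamma>2 \<beta>2 \<and>
            (\<forall>l\<in>carrier (base E1). \<gamma>1 l = \<gamma>2 (\<gamma> l))))"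
    (is "_ \<longleftrightarrow> (\<exists>T. ?embeds T)")
proof
  assume "induces_isoclinism K E1 E2 \<gamma>"
  then obtain \<beta>' where "isoclinism K E1 E2 \<gamma> \<beta>'" by (auto simp: induces_isoclinism_def)
  then interpret isoclinic_pair K E1 E2 \<gamma> \<beta>'
    using assms by (intro isoclinic_pair.intro extension_pair.intro extension_pair_axioms.intro
        isoclinic_pair_axioms.intro)
  have "\<forall>l\<in>carrier (base E1). id l = inv_into (carrier (base E1)) \<gamma> (\<gamma> l)"
    using bij_betw_inv_into_left[OF iso_bij] by simp
  then show "\<exists>T. ?embeds T"
    using T_ideal T_kernel isoclinic_mono1 isoclinic_mono2 by blast
next
  assume "\<exists>T. ?embeds T"
  then show "induces_isoclinism K E1 E2 \<gamma>"
    using assms(7,8) by (blast intro: induces_isoclinism_if_isoclinic_monos)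
qed

end
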